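(* Let $n\ge1$ and $m\ge0$. Let $\{a_1,\dots,a_{n!}\}$ be a basis of ${\bf QI}_{m+1}$ and $\{b_1,\dots,b_{n!}\}$ a basis of ${\bf QI}_m$, both as free $\Lambda_n$-modules, and let $B=(B_{st})$ be the matrix with entries in $\Lambda_n$ such that $a_s=\sum_t B_{st}b_t$. Then $\det B$ is a rational scalar multiple of $\Delta_n^{\,n!}$, where $\Delta_n=\prod_{1\le i<j\le n}(x_i-x_j)$.
   Context: $S_n$ acts on $\mathbb{Q}[x_1,\dots,x_n]$ by permuting indices of variables; $\Lambda_n$ is the ring of symmetric polynomials. ${\bf QI}_m$ is the ring of $P\in\mathbb{Q}[x_1,\dots,x_n]$ such that $(x_i-x_j)^{2m+1}$ divides $P-(i,j)P$ for every transposition $(i,j)$; one has ${\bf QI}_{m+1}\subseteq{\bf QI}_m$. It is known (Etingof–Ginzburg) that each ${\bf QI}_m$ is a free $\Lambda_n$-module of rank $n!$, and (Felder–Veselov) that it has a homogeneous $\Lambda_n$-basis $\{\beta_{S,T}\}$ indexed by pairs of standard tableaux of the same shape $\lambda\vdash n$ with $\deg\beta_{S,T}=m(\binom n2-\mathrm{content}(\lambda))+\mathrm{cocharge}(T)$. *)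

theory Defs
  imports
    "HOL-Library.Poly_Mapping"
    "HOL-Combinatorics.Permutations"
    "Jordan_Normal_Form.Determinant"
begin

text \<open>
  Polynomials over the rationals in variables indexed by natural numbers: finitely supported
  coefficient functions on exponent vectors. Only the variables with index in \<open>{1..n}\<close> are used;
  \<open>poly_ring n\<close> below is the ring in these \<open>n\<close> variables.
\<close>

type_synonym rpoly = "(nat \<Rightarrow>\<^sub>0 nat) \<Rightarrow>\<^sub>0 rat"

definition const :: "rat \<Rightarrow> rpoly" where
  "const c = Poly_Mapping.single 0 c"

definition X :: "nat \<Rightarrow> rpoly" where
  "X i = Poly_Mapping.single (Poly_Mapping.single i 1) 1"

definition poly_ring :: "nat \<Rightarrow> rpoly set" where
  "poly_ring n = {P. \<forall>e \<in> Poly_Mapping.keys P. Poly_Mapping.keys e \<subseteq> {1..n}}"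

text \<open>The action of a permutation: substitute \<open>X (\<pi> i)\<close> for \<open>X i\<close>.\<close>

definition perm_act :: "(nat \<Rightarrow> nat) \<Rightarrow> rpoly \<Rightarrow> rpoly" where
  "perm_act \<pi> P =
     (\<Sum>e \<in> Poly_Mapping.keys P. const (Poly_Mapping.lookup P e) *
        (\<Prod>i \<in> Poly_Mapping.keys e. X (\<pi> i) ^ Poly_Mapping.lookup e i))"

definition sym_polys :: "nat \<Rightarrow> rpoly set" where
  "sym_polys n = {P \<in> poly_ring n. \<forall>\<pi>. \<pi> permutes {1..n} \<longrightarrow> perm_act \<pi> P = P}"

text \<open>
  Divisibility is spelled out with a cofactor in \<open>poly_ring n\<close>, since \<open>dvd\<close> on the type would
  refer to the ring in infinitely many variables.
\<close>

definition QI :: "nat \<Rightarrow> nat \<Rightarrow> rpoly set" where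
  "QI n m = {P \<in> poly_ring n.
     \<forall>i \<in> {1..n}. \<forall>j \<in> {1..n}. i \<noteq> j \<longrightarrow>
       (\<exists>Q \<in> poly_ring n.
          P - perm_act (Transposition.transpose i j) P = (X i - X j) ^ (2 * m + 1) * Q)}"

text \<open>
  The family \<open>v 0, \<dots>, v (N - 1)\<close> is a basis of \<open>M\<close> as a free module over the symmetric
  polynomials in \<open>n\<close> variables. Indices start at 0 to agree with the indices of matrices.
\<close>

definition is_sym_basis :: "nat \<Rightarrow> rpoly set \<Rightarrow> nat \<Rightarrow> (nat \<Rightarrow> rpoly) \<Rightarrow> bool" where
  "is_sym_basis n M N v \<longleftrightarrow>
     (\<forall>s<N. v s \<in> M) \<and>
     (\<forall>P \<in> M. \<exists>c. (\<forall>s<N. c s \<in> sym_polys n) \<and> P = (\<Sum>s<N. c s * v s)) \<and>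
     (\<forall>c. (\<forall>s<N. c s \<in> sym_polys n) \<and> (\<Sum>s<N. c s * v s) = 0 \<longrightarrow> (\<forall>s<N. c s = 0))"

definition vandermonde :: "nat \<Rightarrow> rpoly" where
  "vandermonde n = (\<Prod>(i, j) \<in> {(i, j). 1 \<le> i \<and> i < j \<and> j \<le> n}. (X i - X j))"

end

(* Fix i < j, put d = x_i - x_j and let s be the transposition of i and j. Modulo d the n!
   permutations give n!/2 distinct characters P |-> sigma P of the ring QI_m, and as many
   maps P |-> (sigma P - s sigma P) / d^(2m+1). Together these n! maps are linearly independent
   modulo d by Dedekind's argument, so the matrix of their values at a basis of QI_m has a
   determinant not divisible by d. Passing from the basis b of QI_m to the basis a of QI_(m+1)
   multiplies this matrix by B, while half of the maps are rescaled by d^2; hence d occurs in det B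
   exactly n! times. Since Delta^2 QI_m is contained in QI_(m+1), det B divides Delta^(2 n!), so
   there are no other prime factors. *)
theory Submission
  imports Defs
begin

section \<open>Substitution homomorphisms\<close>

text \<open>Divisibility by x_i - x_j amounts to vanishing under the endomorphism x_j := x_i, so
  primality and reduction modulo d both come from one substitution with values in an integral
  domain. This substitution absorbs the transposition s, which is why characters coincide in pairs;
  the divided differences recover what is lost. Dedekind's argument needs the remaining characters
  to differ on QI_m, which need not contain the variables. Separating elements therefore have to be
  built: powers of all differences except that of one pair, times a factor invariant under the
  transposition of that pair. Independence modulo d holds at both levels. For b it yields the factor
  d^(n!) of det B, for a it shows that the remaining cofactor is prime to d. The exponent is 2 *
  (n!/2), where 2 is the gap between 2m+3 and 2m+1. The bound by Delta^(2 n!) comes from inverting B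
  up to the scalar Delta^2.\<close>

lemma poly_mapping_eq_sum_single:
  "P = (\<Sum>e\<in>Poly_Mapping.keys P. Poly_Mapping.single e (Poly_Mapping.lookup P e))"
  by (rule poly_mapping_eqI)
    (auto simp: lookup_sum lookup_single when_def in_keys_iff sum.delta)

lemma poly_mapping_single_add_induct:
  fixes P :: "'a \<Rightarrow>\<^sub>0 'b::comm_monoid_add"
  assumes "\<And>e c. S (Poly_Mapping.single e c)" "\<And>P Q. S P \<Longrightarrow> S Q \<Longrightarrow> S (P + Q)"
  shows "S P"
proof -
  have S0: "S 0" using assms(1)[of undefined 0] by simp
  have "S (\<Sum>e\<in>A. Poly_Mapping.single e (Poly_Mapping.lookup P e))" if "finite A" for A
    using that by (induction A) (auto intro: assms S0)
  from this[OF finite_keys, of P] show ?thesis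
    using poly_mapping_eq_sum_single[of P] by simp
qed

definition subst_monom :: "(nat \<Rightarrow> 'a::comm_ring_1) \<Rightarrow> (nat \<Rightarrow>\<^sub>0 nat) \<Rightarrow> 'a" where
  "subst_monom f e = (\<Prod>i\<in>Poly_Mapping.keys e. f i ^ Poly_Mapping.lookup e i)"

text \<open>Coefficients pass through \<open>\<kappa>\<close> so that one construction serves both
  the action on the ring itself and the embedding into univariate polynomials that detects
  units.\<close>

definition subst :: "(rat \<Rightarrow> 'a) \<Rightarrow> (nat \<Rightarrow> 'a::comm_ring_1) \<Rightarrow> rpoly \<Rightarrow> 'a" where
  "subst \<kappa> f P = (\<Sum>e\<in>Poly_Mapping.keys P. \<kappa> (Poly_Mapping.lookup P e) * subst_monom f e)"

lemma subst_monom_superset: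
  assumes "finite A" "Poly_Mapping.keys e \<subseteq> A"
  shows "subst_monom f e = (\<Prod>i\<in>A. f i ^ Poly_Mapping.lookup e i)"
  unfolding subst_monom_def using assms
  by (intro prod.mono_neutral_left) (auto simp: in_keys_iff)

lemma subst_monom_add: "subst_monom f (e + e') = subst_monom f e * subst_monom f e'"
proof -
  let ?A = "Poly_Mapping.keys e \<union> Poly_Mapping.keys e'"
  have "Poly_Mapping.keys (e + e') \<subseteq> ?A" by (rule keys_add)
  then show ?thesis
    by (simp add: subst_monom_superset[of ?A] lookup_add power_add prod.distrib)
qed

lemma single_eq_subst_monom: "Poly_Mapping.single e c = const c * subst_monom X e"
proof -
  have X_power: "X i ^ k = Poly_Mapping.single (Poly_Mapping.single i k) 1" for i k
    by (induction k) (auto simp: X_def mult_single simp flip: single_add)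
  have "(\<Prod>i\<in>A. X i ^ g i) = Poly_Mapping.single (\<Sum>i\<in>A. Poly_Mapping.single i (g i)) 1"
    if "finite A" for A g
    using that by (induction A) (auto simp: X_power mult_single)
  from this[of "Poly_Mapping.keys e" "Poly_Mapping.lookup e"] 
  have "subst_monom X e = Poly_Mapping.single e 1"
    unfolding subst_monom_def by (simp flip: poly_mapping_eq_sum_single)
  then show ?thesis by (simp add: const_def mult_single)
qed

lemma const_add: "const (a + b) = const a + const b"
  and const_mult: "const (a * b) = const a * const b"
  and const_0: "const 0 = 0"
  and const_1: "const 1 = 1"
  by (simp_all add: const_def single_add mult_single)

text \<open>Constants and variables generate the ring, so ring homomorphisms need to be compared on
  these only.\<close>

lemma rpoly_induct [case_names const X add mult]:
  assumes "\<And>c. S (const c)" "\<And>i. S (X i)"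
    "\<And>P Q. S P \<Longrightarrow> S Q \<Longrightarrow> S (P + Q)" "\<And>P Q. S P \<Longrightarrow> S Q \<Longrightarrow> S (P * Q)"
  shows "S P"
proof (induction P rule: poly_mapping_single_add_induct)
  case (1 e c)
  have S1: "S 1" using assms(1)[of 1] by (simp add: const_1)
  have pow: "S (X i ^ k)" for i k
    by (induction k) (auto intro: S1 assms)
  have "S (\<Prod>i\<in>A. X i ^ g i)" if "finite A" for A g
    using that by (induction A) (auto intro: S1 assms pow)
  then show ?case
    unfolding single_eq_subst_monom subst_monom_def by (auto intro: assms)
qed (rule assms)

locale rat_hom =
  fixes \<kappa> :: "rat \<Rightarrow> 'a::comm_ring_1"
  assumes add: "\<kappa> (a + b) = \<kappa> a + \<kappa> b"
    and mult: "\<kappa> (a * b) = \<kappa> a * \<kappa> b"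
    and one: "\<kappa> 1 = 1"
begin

lemma zero: "\<kappa> 0 = 0"
  using add[of 0 0] by simp

lemma subst_superset:
  assumes "finite A" "Poly_Mapping.keys P \<subseteq> A"
  shows "subst \<kappa> f P = (\<Sum>e\<in>A. \<kappa> (Poly_Mapping.lookup P e) * subst_monom f e)"
  unfolding subst_def using assms
  by (intro sum.mono_neutral_left) (auto simp: in_keys_iff zero)

lemma subst_add: "subst \<kappa> f (P + Q) = subst \<kappa> f P + subst \<kappa> f Q"
proof -
  let ?A = "Poly_Mapping.keys P \<union> Poly_Mapping.keys Q"
  have "Poly_Mapping.keys (P + Q) \<subseteq> ?A" by (rule keys_add)
  then show ?thesis
    by (simp add: subst_superset[of ?A] lookup_add add distrib_right sum.distrib)
qed

lemma subst_single: "subst \<kappa> f (Poly_Mapping.single e c) = \<kappa> c * subst_monom f e"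
  by (simp add: subst_superset[of "{e}"])

lemma subst_mult: "subst \<kappa> f (P * Q) = subst \<kappa> f P * subst \<kappa> f Q"
proof (induction P rule: poly_mapping_single_add_induct)
  case (1 e c)
  show ?case
    by (induction Q rule: poly_mapping_single_add_induct)
      (simp_all add: mult_single subst_single subst_monom_add mult subst_add algebra_simps)
qed (simp add: subst_add distrib_right)

lemma subst_const: "subst \<kappa> f (const c) = \<kappa> c"
  by (simp add: const_def subst_single subst_monom_def)

lemma subst_X: "subst \<kappa> f (X i) = f i"
  by (simp add: X_def subst_single subst_monom_def one)

lemma subst_1: "subst \<kappa> f 1 = 1"
  using subst_const[of f 1] by (simp add: const_1 one)

lemma comm_ring_hom_subst: "comm_ring_hom (subst \<kappa> f)"
proof
  show "subst \<kappa> f 0 = 0" by (simp add: subst_def)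
qed (simp_all add: subst_add subst_mult subst_1)

end

lemma rat_hom_const: "rat_hom const"
  by unfold_locales (simp_all add: const_add const_mult const_1)

lemma perm_act_eq_subst: "perm_act \<pi> = subst const (\<lambda>i. X (\<pi> i))"
  by (simp add: fun_eq_iff perm_act_def subst_def subst_monom_def)

text \<open>The index map may be any function. Non-injective ones matter below: identifying two
  variables and retracting onto finitely many variables are both instances of this action.\<close>

interpretation perm_act: comm_ring_hom "perm_act \<pi>" for \<pi>
  unfolding perm_act_eq_subst by (rule rat_hom.comm_ring_hom_subst[OF rat_hom_const])

lemma perm_act_const [simp]: "perm_act \<pi> (const c) = const c"
  unfolding perm_act_eq_subst by (rule rat_hom.subst_const[OF rat_hom_const])

lemma perm_act_X [simp]: "perm_act \<pi> (X i) = X (\<pi> i)"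
  unfolding perm_act_eq_subst by (rule rat_hom.subst_X[OF rat_hom_const])

lemma perm_act_comp: "perm_act \<pi> (perm_act \<rho> P) = perm_act (\<pi> \<circ> \<rho>) P"
  by (induction P rule: rpoly_induct) (simp_all add: hom_distribs)

lemma perm_act_cong:
  "(\<And>i e. e \<in> Poly_Mapping.keys P \<Longrightarrow> i \<in> Poly_Mapping.keys e \<Longrightarrow> \<pi> i = \<rho> i)
    \<Longrightarrow> perm_act \<pi> P = perm_act \<rho> P"
  by (simp add: perm_act_def)

lemma perm_act_id [simp]: "perm_act id P = P" "perm_act (\<lambda>i. i) P = P"
  by (induction P rule: rpoly_induct) (simp_all add: hom_distribs)

text \<open>Scaling all variables by a new one embeds the ring into a univariate polynomial ring over
  itself; a unit there has degree 0, so its values at 1 and at 0 agree.\<close>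

lemma rpoly_unit_const:
  fixes P :: rpoly
  assumes "P * Q = 1"
  shows "\<exists>c. P = const c"
proof -
  interpret \<kappa>: rat_hom "\<lambda>c. [:const c:]"
    by unfold_locales (simp_all add: const_add const_mult const_1 one_pCons)
  let ?h = "subst (\<lambda>c. [:const c:]) (\<lambda>i. [:0, X i:])"
  have at_1: "poly (?h R) 1 = R" for R
    by (induction R rule: rpoly_induct)
      (simp_all add: \<kappa>.subst_const \<kappa>.subst_X \<kappa>.subst_add \<kappa>.subst_mult)
  have at_0: "\<exists>c. poly (?h R) 0 = const c" for R
  proof (induction R rule: rpoly_induct)
    case (X i)
    show ?case by (simp add: \<kappa>.subst_X) (metis const_0)
  next
    case (add P Q)
    then show ?case by (auto simp add: \<kappa>.subst_add) (metis const_add)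
  next
    case (mult P Q)
    then show ?case by (auto simp add: \<kappa>.subst_mult) (metis const_mult)
  qed (auto simp: \<kappa>.subst_const)
  have "?h P * ?h Q = 1" using assms by (metis \<kappa>.subst_mult \<kappa>.subst_1)
  then have "degree (?h P * ?h Q) = 0" "?h P \<noteq> 0" "?h Q \<noteq> 0" by auto
  then have "degree (?h P) = 0" by (simp add: degree_mult_eq)
  then obtain c where "?h P = [:c:]" by (rule degree_eq_zeroE)
  then show ?thesis using at_1[of P] at_0[of P] by simp
qed

section \<open>Divisibility by differences of variables\<close>

lemma X_eq_iff [simp]: "X i = X j \<longleftrightarrow> i = j"
proof
  assume "X i = X j"
  then have "Poly_Mapping.single i (1 :: nat) = Poly_Mapping.single j 1"
    unfolding X_def by (metis lookup_single_eq lookup_single_not_eq zero_neq_one)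
  then show "i = j"
    by (metis lookup_single_eq lookup_single_not_eq zero_neq_one)
qed simp

definition collapse :: "nat \<Rightarrow> nat \<Rightarrow> nat \<Rightarrow> nat" where
  "collapse i j k = (if k = j then i else k)"

abbreviation merge :: "nat \<Rightarrow> nat \<Rightarrow> rpoly \<Rightarrow> rpoly" where
  "merge i j \<equiv> perm_act (collapse i j)"

text \<open>The product case is the twisted Leibniz rule P Q - P' Q' = P (Q - Q') + (P - P')
  Q'.\<close>

lemma diff_dvd_minus_merge: "X i - X j dvd P - merge i j P"
proof (induction P rule: rpoly_induct)
  case (X k)
  have "X j - X i = (X i - X j) * (- 1)" by simp
  then have "X i - X j dvd X j - X i" by (rule dvdI)
  then show ?case by (simp add: collapse_def)
next
  case (add P Q)
  then have "X i - X j dvd (P - merge i j P) + (Q - merge i j Q)" by (rule dvd_add)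
  then show ?case by (simp add: hom_distribs algebra_simps)
next
  case (mult P Q)
  then have "X i - X j dvd P * (Q - merge i j Q) + (P - merge i j P) * merge i j Q"
    by (intro dvd_add dvd_mult dvd_mult2)
  then show ?case by (simp add: hom_distribs algebra_simps)
qed simp

lemma merge_eq_0_iff: "merge i j P = 0 \<longleftrightarrow> X i - X j dvd P"
proof
  assume "merge i j P = 0"
  then show "X i - X j dvd P" using diff_dvd_minus_merge[of i j P] by simp
next
  assume "X i - X j dvd P"
  then show "merge i j P = 0" by (auto simp: hom_distribs collapse_def)
qed

lemma merge_transpose:
  "merge i j (perm_act (Transposition.transpose i j \<circ> \<pi>) P) = merge i j (perm_act \<pi> P)"
proof -
  have "collapse i j \<circ> (Transposition.transpose i j \<circ> \<pi>) = collapse i j \<circ> \<pi>"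
    by (auto simp: fun_eq_iff Transposition.transpose_def collapse_def)
  then show ?thesis by (simp only: perm_act_comp)
qed

text \<open>The multiples of \<open>X i - X j\<close> form the kernel of an endomorphism of an
  integral domain, and such a kernel is a prime ideal.\<close>

lemma prime_elem_diff:
  assumes "i \<noteq> j"
  shows "prime_elem (X i - X j)"
proof (rule prime_elemI)
  show "\<not> X i - X j dvd 1"
    by (simp flip: merge_eq_0_iff)
qed (use assms in \<open>auto simp flip: merge_eq_0_iff simp: hom_distribs\<close>)

lemma diff_dvd_diff_iff:
  assumes "i \<noteq> j" "k \<noteq> l"
  shows "X i - X j dvd X k - X l \<longleftrightarrow> {k, l} = {i, j}"
  using assms
  by (auto simp flip: merge_eq_0_iff simp: hom_distribs doubleton_eq_iff collapse_def)

section \<open>Powers of prime elements in an integral domain\<close>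

lemma prime_elem_power_dvd_cancel:
  fixes p :: "'a::idom"
  assumes "prime_elem p" "p ^ k dvd a * b" "\<not> p dvd b"
  shows "p ^ k dvd a"
  using assms(2)
proof (induction k arbitrary: a)
  case (Suc k)
  have "p dvd a * b" using Suc.prems by (metis dvd_mult_left power_Suc)
  then obtain a' where a: "a = p * a'"
    using assms(1,3) by (auto simp: prime_elem_dvd_mult_iff)
  have "p * p ^ k dvd p * (a' * b)"
    using Suc.prems unfolding a power_Suc by (simp only: mult.assoc)
  moreover have "p \<noteq> 0" using assms(1) by (simp add: prime_elem_def)
  ultimately have "p ^ k dvd a' * b" by (simp only: dvd_mult_cancel_left) simp
  then show ?case using Suc.IH[of a'] a by (simp add: mult_dvd_mono)
qed simp

lemma prime_elem_dvd_prod: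
  fixes p :: "'a::idom"
  assumes "finite A" "prime_elem p" "p dvd (\<Prod>x\<in>A. f x)"
  shows "\<exists>x\<in>A. p dvd f x"
  using assms
  by (induction A) (auto simp: prime_elem_dvd_mult_iff dest: prime_elem_not_unit)

text \<open>Primes that do not divide one another can be split off in turn: a power of the new prime
  passes over the powers of the earlier ones to their cofactor.\<close>

lemma prod_prime_elem_power_dvd:
  fixes p :: "'b \<Rightarrow> 'a::idom"
  assumes "finite A" "\<And>x. x \<in> A \<Longrightarrow> prime_elem (p x)" "\<And>x. x \<in> A \<Longrightarrow> p x ^ k dvd a"
    "\<And>x y. x \<in> A \<Longrightarrow> y \<in> A \<Longrightarrow> x \<noteq> y \<Longrightarrow> \<not> p x dvd p y"
  shows "(\<Prod>x\<in>A. p x) ^ k dvd a"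
  using assms
proof (induction A)
  case (insert x A)
  then have "(\<Prod>x\<in>A. p x) ^ k dvd a" by blast
  then obtain c where c: "a = c * (\<Prod>x\<in>A. p x) ^ k" by (metis dvdE mult.commute)
  have "\<not> p x dvd (\<Prod>x\<in>A. p x)"
  proof
    assume "p x dvd (\<Prod>x\<in>A. p x)"
    from prime_elem_dvd_prod[OF insert.hyps(1) insert.prems(1) this] insert show False by auto
  qed
  then have "\<not> p x dvd (\<Prod>x\<in>A. p x) ^ k"
    using insert.prems(1)[of x] prime_elem_dvd_power by auto
  moreover have "p x ^ k dvd c * (\<Prod>x\<in>A. p x) ^ k"
    using insert.prems(2)[of x] unfolding c by blast
  moreover have "prime_elem (p x)" using insert.prems(1) by blast
  ultimately have "p x ^ k dvd c" using prime_elem_power_dvd_cancel by blast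
  then show ?case using insert.hyps c by (simp add: power_mult_distrib mult_dvd_mono)
qed simp

section \<open>Polynomials in n variables as the fixed points of a retraction\<close>

definition retract :: "nat \<Rightarrow> nat \<Rightarrow> nat" where
  "retract n i = (if i \<in> {1..n} then i else 1)"

lemma poly_ring_add: "P \<in> poly_ring n \<Longrightarrow> Q \<in> poly_ring n \<Longrightarrow> P + Q \<in> poly_ring n"
  using keys_add[of P Q] by (auto simp: poly_ring_def)

lemma poly_ring_mult: "P \<in> poly_ring n \<Longrightarrow> Q \<in> poly_ring n \<Longrightarrow> P * Q \<in> poly_ring n"
  unfolding poly_ring_def
proof (intro CollectI ballI)
  fix e
  assume P: "P \<in> {P. \<forall>e\<in>Poly_Mapping.keys P. Poly_Mapping.keys e \<subseteq> {1..n}}"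
    and Q: "Q \<in> {P. \<forall>e\<in>Poly_Mapping.keys P. Poly_Mapping.keys e \<subseteq> {1..n}}"
    and "e \<in> Poly_Mapping.keys (P * Q)"
  then obtain d d' where e: "e = d + d'" and "d \<in> Poly_Mapping.keys P" "d' \<in> Poly_Mapping.keys Q"
    using keys_mult[of P Q] by blast
  then have "Poly_Mapping.keys d \<union> Poly_Mapping.keys d' \<subseteq> {1..n}" using P Q by blast
  then show "Poly_Mapping.keys e \<subseteq> {1..n}" using keys_add[of d d'] e by blast
qed

lemma poly_ring_X: "i \<in> {1..n} \<Longrightarrow> X i \<in> poly_ring n"
  by (simp add: poly_ring_def X_def)

lemma perm_act_in_poly_ring:
  assumes "\<And>i. \<pi> i \<in> {1..n}"
  shows "perm_act \<pi> P \<in> poly_ring n"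
proof (induction P rule: rpoly_induct)
  case (const c)
  have "const c \<in> poly_ring n" by (simp add: poly_ring_def const_def)
  then show ?case by simp
next
  case (X i)
  show ?case using poly_ring_X[OF assms[of i]] by simp
qed (simp_all add: hom_distribs poly_ring_add poly_ring_mult)

text \<open>Acting by \<open>retract n\<close> is a ring endomorphism with image in
  \<open>poly_ring n\<close>, so membership becomes an equation that is compatible with ring
  operations and with cancellation. The default index 1 is in range since n \<ge> 1.\<close>

lemma poly_ring_iff:
  assumes "n \<ge> 1"
  shows "P \<in> poly_ring n \<longleftrightarrow> perm_act (retract n) P = P"
proof
  assume "P \<in> poly_ring n"
  then have "perm_act (retract n) P = perm_act id P"
    by (intro perm_act_cong) (auto simp: poly_ring_def retract_def subset_iff simp del: One_nat_def)
  then show "perm_act (retract n) P = P" by simp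
next
  assume "perm_act (retract n) P = P"
  moreover have "perm_act (retract n) P \<in> poly_ring n"
    using assms by (intro perm_act_in_poly_ring) (auto simp: retract_def)
  ultimately show "P \<in> poly_ring n" by simp
qed

lemma perm_act_poly_ring:
  assumes "n \<ge> 1" "\<pi> permutes {1..n}" "P \<in> poly_ring n"
  shows "perm_act \<pi> P \<in> poly_ring n"
proof -
  have "retract n \<circ> \<pi> \<circ> retract n = \<pi> \<circ> retract n"
    using assms(1) permutes_in_image[OF assms(2)] by (auto simp: fun_eq_iff retract_def)
  then have "perm_act (retract n) (perm_act \<pi> (perm_act (retract n) P))
      = perm_act \<pi> (perm_act (retract n) P)"
    by (simp add: perm_act_comp o_assoc)
  then show ?thesis using assms by (simp add: poly_ring_iff)
qed

text \<open>The retraction fixes P and D, so cancelling D shows that it fixes Q as well.\<close>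

lemma poly_ring_cofactor:
  assumes "n \<ge> 1" "P \<in> poly_ring n" "D \<in> poly_ring n" "D \<noteq> 0" "P = D * Q"
  shows "Q \<in> poly_ring n"
proof -
  have "D * perm_act (retract n) Q = D * Q"
    using assms by (metis perm_act.hom_mult poly_ring_iff)
  then show ?thesis using assms(1,4) by (simp add: poly_ring_iff)
qed

text \<open>A cofactor found in the ambient ring already lies in \<open>poly_ring n\<close>, so
  plain \<open>dvd\<close> expresses quasi-invariance.\<close>

lemma QI_iff:
  assumes "n \<ge> 1"
  shows "P \<in> QI n m \<longleftrightarrow> P \<in> poly_ring n \<and> (\<forall>i\<in>{1..n}. \<forall>j\<in>{1..n}. i \<noteq> j \<longrightarrow>
    (X i - X j) ^ (2 * m + 1) dvd P - perm_act (Transposition.transpose i j) P)"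
proof -
  have "(\<exists>Q\<in>poly_ring n. P - perm_act (Transposition.transpose i j) P = (X i - X j) ^ (2 * m + 1) * Q)
      \<longleftrightarrow> (X i - X j) ^ (2 * m + 1) dvd P - perm_act (Transposition.transpose i j) P"
    (is "?L \<longleftrightarrow> ?R")
    if "P \<in> poly_ring n" "i \<in> {1..n}" "j \<in> {1..n}" "i \<noteq> j" for i j
  proof
    assume ?R
    then obtain Q where Q: "P - perm_act (Transposition.transpose i j) P = (X i - X j) ^ (2 * m + 1) * Q"
      by (rule dvdE)
    have t: "Transposition.transpose i j permutes {1..n}"
      using that by (intro permutes_swap_id) auto
    have "Q \<in> poly_ring n"
    proof (rule poly_ring_cofactor[OF assms _ _ _ Q])
      show "P - perm_act (Transposition.transpose i j) P \<in> poly_ring n"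
        using that(1) perm_act_poly_ring[OF assms t that(1)] assms
        by (simp add: poly_ring_iff hom_distribs)
      show "(X i - X j) ^ (2 * m + 1) \<in> poly_ring n"
        using poly_ring_X[OF that(2)] poly_ring_X[OF that(3)] assms
        by (simp add: poly_ring_iff hom_distribs)
    qed (use that in simp)
    with Q show ?L by blast
  qed auto
  then show ?thesis by (auto simp: QI_def)
qed

section \<open>The Vandermonde product\<close>

definition pairs :: "nat \<Rightarrow> (nat \<times> nat) set" where
  "pairs n = {(i, j). 1 \<le> i \<and> i < j \<and> j \<le> n}"

definition distinct_pairs :: "nat \<Rightarrow> (nat \<times> nat) set" where
  "distinct_pairs n = {(i, j). i \<in> {1..n} \<and> j \<in> {1..n} \<and> i \<noteq> j}"

abbreviation diff :: "nat \<times> nat \<Rightarrow> rpoly" where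
  "diff \<equiv> \<lambda>(i, j). X i - X j"

lemma finite_pairs [simp]: "finite (pairs n)" "finite (distinct_pairs n)"
  by (rule finite_subset[of _ "{1..n} \<times> {1..n}"]; force simp: pairs_def distinct_pairs_def)+

lemma vandermonde_eq: "vandermonde n = prod diff (pairs n)"
  by (simp add: vandermonde_def pairs_def)

lemma pairs_subset: "pairs n \<subseteq> distinct_pairs n"
  by (auto simp: pairs_def distinct_pairs_def)

lemma vandermonde_neq_0: "vandermonde n \<noteq> 0"
  unfolding vandermonde_eq by (subst prod_zero_iff[OF finite_pairs(1)]) (auto simp: pairs_def)

lemma distinct_pairs_permutes:
  assumes "\<pi> permutes {1..n}"
  shows "bij_betw (map_prod \<pi> \<pi>) (distinct_pairs n) (distinct_pairs n)"
proof (rule bij_betw_byWitness[where f' = "map_prod (inv_into UNIV \<pi>) (inv_into UNIV \<pi>)"])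
  show "map_prod \<pi> \<pi> ` distinct_pairs n \<subseteq> distinct_pairs n"
    using permutes_in_image[OF assms] permutes_inj[OF assms]
    by (auto simp: distinct_pairs_def simp del: atLeastAtMost_iff dest: injD)
  show "map_prod (inv_into UNIV \<pi>) (inv_into UNIV \<pi>) ` distinct_pairs n \<subseteq> distinct_pairs n"
    using permutes_in_image[OF permutes_inv[OF assms]] permutes_inj[OF permutes_inv[OF assms]]
    by (auto simp: distinct_pairs_def simp del: atLeastAtMost_iff dest: injD)
qed (use permutes_inverses[OF assms] in auto)

text \<open>Ordered pairs spare the sign bookkeeping: permutations merely permute the factors.\<close>

lemma perm_act_prod_distinct_pairs:
  assumes "\<pi> permutes {1..n}"
  shows "perm_act \<pi> (prod diff (distinct_pairs n)) = prod diff (distinct_pairs n)"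
proof -
  have "perm_act \<pi> (prod diff (distinct_pairs n))
      = (\<Prod>p\<in>distinct_pairs n. diff (map_prod \<pi> \<pi> p))"
    by (simp add: perm_act.hom_prod split_beta hom_distribs)
  also have "\<dots> = prod diff (distinct_pairs n)"
    using prod.reindex_bij_betw[OF distinct_pairs_permutes[OF assms]] .
  finally show ?thesis .
qed

lemma prod_distinct_pairs:
  "prod diff (distinct_pairs n) = (- 1) ^ card (pairs n) * vandermonde n ^ 2"
proof -
  have swap: "distinct_pairs n = pairs n \<union> prod.swap ` pairs n"
    by (auto simp: distinct_pairs_def pairs_def image_iff)
  have "prod diff (prod.swap ` pairs n) = (\<Prod>p\<in>pairs n. - 1 * diff p)"
    by (subst prod.reindex) (auto simp: split_beta)
  also have "\<dots> = (- 1) ^ card (pairs n) * vandermonde n"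
    unfolding prod.distrib by (simp add: vandermonde_eq)
  finally show ?thesis
    unfolding swap by (subst prod.union_disjoint)
      (use finite_pairs in \<open>auto simp: pairs_def vandermonde_eq power2_eq_square\<close>)
qed

text \<open>The square is invariant by the product over ordered pairs, and square roots in an
  integral domain agree up to sign.\<close>

lemma perm_act_vandermonde:
  assumes "\<pi> permutes {1..n}"
  shows "perm_act \<pi> (vandermonde n) = vandermonde n \<or>
    perm_act \<pi> (vandermonde n) = - vandermonde n"
proof -
  have "(- 1) ^ card (pairs n) * perm_act \<pi> (vandermonde n) ^ 2
      = (- 1) ^ card (pairs n) * vandermonde n ^ 2"
    using perm_act_prod_distinct_pairs[OF assms] by (simp add: prod_distinct_pairs hom_distribs)
  then show ?thesis by (simp add: power2_eq_iff)
qed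

lemma diff_commute_dvd: "X j - X i dvd P \<longleftrightarrow> X i - X j dvd (P :: rpoly)"
  using minus_dvd_iff[of "X i - X j" P] by simp

lemma diff_dvd_vandermonde:
  assumes "(i, j) \<in> distinct_pairs n"
  shows "X i - X j dvd vandermonde n"
proof -
  have *: "X a - X b dvd vandermonde n" if "(a, b) \<in> pairs n" for a b
    unfolding vandermonde_eq using dvd_prodI[OF _ that, of diff] by simp
  have "(i, j) \<in> pairs n \<or> (j, i) \<in> pairs n"
    using assms by (auto simp: pairs_def distinct_pairs_def)
  then show ?thesis using *[of i j] *[of j i] diff_commute_dvd by blast
qed

lemma transpose_permutes:
  "(i, j) \<in> distinct_pairs n \<Longrightarrow> Transposition.transpose i j permutes {1..n}"
  by (intro permutes_swap_id) (auto simp: distinct_pairs_def)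

text \<open>The cofactor of \<open>X i - X j\<close> in the Vandermonde product does not vanish for \<open>X j = X i\<close>, which
  excludes the sign \<open>+\<close> for the action of the transposition.\<close>

lemma vandermonde_cofactor:
  assumes "(i, j) \<in> pairs n"
  obtains Y where "vandermonde n = (X i - X j) * Y" "merge i j Y \<noteq> 0"
    "\<not> X i - X j dvd Y"
proof
  let ?Y = "prod diff (pairs n - {(i, j)})"
  show "vandermonde n = (X i - X j) * ?Y"
    unfolding vandermonde_eq using assms by (subst prod.remove[of _ "(i, j)"]) auto
  show "\<not> X i - X j dvd ?Y"
  proof
    assume "X i - X j dvd ?Y"
    moreover have ij: "i \<noteq> j" using assms by (auto simp: pairs_def)
    ultimately obtain k l where "(k, l) \<in> pairs n - {(i, j)}" "X i - X j dvd X k - X l"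
      using prime_elem_dvd_prod[OF _ prime_elem_diff[OF ij], of "pairs n - {(i, j)}" diff] by auto
    with assms ij show False
      by (subst (asm) diff_dvd_diff_iff) (auto simp: pairs_def doubleton_eq_iff)
  qed
  then show "merge i j ?Y \<noteq> 0" by (simp add: merge_eq_0_iff)
qed

text \<open>With the sign +, cancelling \<open>X i - X j\<close>, which itself changes sign, would
  make the cofactor Y antisymmetric. Merging cannot see the transposition, so 2 times the merged Y
  would vanish.\<close>

lemma perm_act_transpose_vandermonde:
  assumes "(i, j) \<in> pairs n"
  shows "perm_act (Transposition.transpose i j) (vandermonde n) = - vandermonde n"
proof (rule ccontr)
  let ?s = "Transposition.transpose i j"
  assume "\<not> ?thesis"
  then have eq: "perm_act ?s (vandermonde n) = vandermonde n"
    using perm_act_vandermonde[OF transpose_permutes] assms pairs_subset by blast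
  obtain Y where Y: "vandermonde n = (X i - X j) * Y" "merge i j Y \<noteq> 0"
    by (rule vandermonde_cofactor[OF assms])
  have "(X i - X j) * (- perm_act ?s Y) = (X i - X j) * Y"
    using eq unfolding Y(1) by (simp add: hom_distribs algebra_simps)
  moreover have "X i - X j \<noteq> 0" using assms by (auto simp: pairs_def)
  ultimately have "- perm_act ?s Y = Y" by (simp only: mult_cancel_left) simp
  then have "merge i j Y = - merge i j (perm_act ?s Y)" by (metis perm_act.hom_uminus)
  also have "merge i j (perm_act ?s Y) = merge i j Y"
    using merge_transpose[of i j id Y] by simp
  finally have "2 * merge i j Y = 0" by simp
  with Y(2) show False by simp
qed

section \<open>Quasi-invariants\<close>

lemma QI_iff_pairs:
  assumes "n \<ge> 1"
  shows "P \<in> QI n m \<longleftrightarrow> P \<in> poly_ring n \<and> (\<forall>(i, j)\<in>distinct_pairs n.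
    (X i - X j) ^ (2 * m + 1) dvd P - perm_act (Transposition.transpose i j) P)"
  unfolding QI_iff[OF assms] by (auto simp: distinct_pairs_def)

lemma QI_mult:
  assumes "n \<ge> 1" "P \<in> QI n m" "Q \<in> QI n m"
  shows "P * Q \<in> QI n m"
  unfolding QI_iff_pairs[OF assms(1)]
proof safe
  show "P * Q \<in> poly_ring n" using assms by (auto simp: QI_iff_pairs intro: poly_ring_mult)
  fix i j assume ij: "(i, j) \<in> distinct_pairs n"
  let ?s = "perm_act (Transposition.transpose i j)"
  have "(X i - X j) ^ (2 * m + 1) dvd P * (Q - ?s Q) + (P - ?s P) * ?s Q"
    using assms ij unfolding QI_iff_pairs[OF assms(1)] by (intro dvd_add dvd_mult dvd_mult2) auto
  then show "(X i - X j) ^ (2 * m + 1) dvd P * Q - ?s (P * Q)"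
    by (simp add: hom_distribs algebra_simps)
qed

lemma poly_ring_1: "1 \<in> poly_ring n"
  by (simp add: poly_ring_def)

lemma QI_1: "n \<ge> 1 \<Longrightarrow> 1 \<in> QI n m"
  by (simp add: QI_iff_pairs poly_ring_1)

lemma prod_diff_poly_ring:
  assumes "n \<ge> 1" "A \<subseteq> distinct_pairs n"
  shows "prod diff A \<in> poly_ring n"
proof -
  have "perm_act (retract n) (diff p) = diff p" if "p \<in> A" for p
    using that assms(2) by (auto simp: distinct_pairs_def retract_def hom_distribs)
  then show ?thesis using assms(1) by (simp add: poly_ring_iff perm_act.hom_prod)
qed

lemma vandermonde_poly_ring: "n \<ge> 1 \<Longrightarrow> vandermonde n \<in> poly_ring n"
  unfolding vandermonde_eq by (rule prod_diff_poly_ring[OF _ pairs_subset])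

lemma vandermonde_power_poly_ring: "n \<ge> 1 \<Longrightarrow> vandermonde n ^ k \<in> poly_ring n"
  using vandermonde_poly_ring[of n] by (simp add: poly_ring_iff hom_distribs)

lemma vandermonde_square_sym: "n \<ge> 1 \<Longrightarrow> vandermonde n ^ 2 \<in> sym_polys n"
  using perm_act_vandermonde[of _ n]
  by (auto simp: sym_polys_def vandermonde_power_poly_ring hom_distribs) (metis power2_minus)

text \<open>The square of the Vandermonde product is symmetric, hence factors out of the difference,
  and it contributes exactly the two missing powers of each \<open>X i - X j\<close>.\<close>

lemma QI_vandermonde_square_mult:
  assumes "n \<ge> 1" "P \<in> QI n m"
  shows "vandermonde n ^ 2 * P \<in> QI n (m + 1)"
  unfolding QI_iff_pairs[OF assms(1)]
proof safe
  show "vandermonde n ^ 2 * P \<in> poly_ring n"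
    using assms vandermonde_power_poly_ring by (auto simp: QI_iff_pairs intro: poly_ring_mult)
  fix i j assume ij: "(i, j) \<in> distinct_pairs n"
  let ?s = "perm_act (Transposition.transpose i j)"
  have "?s (vandermonde n ^ 2) = vandermonde n ^ 2"
    using vandermonde_square_sym[OF assms(1)] transpose_permutes[OF ij] by (simp add: sym_polys_def)
  then have eq: "vandermonde n ^ 2 * P - ?s (vandermonde n ^ 2 * P) = vandermonde n ^ 2 * (P - ?s P)"
    by (simp only: perm_act.hom_mult right_diff_distrib)
  have "(X i - X j) ^ 2 * (X i - X j) ^ (2 * m + 1) dvd vandermonde n ^ 2 * (P - ?s P)"
    using assms ij diff_dvd_vandermonde[OF ij]
    unfolding QI_iff_pairs[OF assms(1)] by (intro mult_dvd_mono dvd_power_same) auto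
  then show "(X i - X j) ^ (2 * (m + 1) + 1) dvd vandermonde n ^ 2 * P - ?s (vandermonde n ^ 2 * P)"
    unfolding eq by (simp add: mult.assoc power2_eq_square)
qed

text \<open>Both terms of each difference are divisible on their own, since a transposition changes
  the Vandermonde product at most by a sign.\<close>

lemma QI_vandermonde_power:
  assumes "n \<ge> 1"
  shows "vandermonde n ^ (2 * m + 1) \<in> QI n m"
  unfolding QI_iff_pairs[OF assms(1)]
proof safe
  show "vandermonde n ^ (2 * m + 1) \<in> poly_ring n"
    using assms by (rule vandermonde_power_poly_ring)
  fix i j assume ij: "(i, j) \<in> distinct_pairs n"
  let ?s = "perm_act (Transposition.transpose i j)"
  have "X i - X j dvd ?s (vandermonde n)"
    using perm_act_vandermonde[OF transpose_permutes[OF ij]] diff_dvd_vandermonde[OF ij] by auto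
  then show "(X i - X j) ^ (2 * m + 1) dvd
      vandermonde n ^ (2 * m + 1) - ?s (vandermonde n ^ (2 * m + 1))"
    unfolding perm_act.hom_power using diff_dvd_vandermonde[OF ij]
    by (intro dvd_diff dvd_power_same)
qed

text \<open>Over ordered pairs, the factor \<open>X a - X b\<close> occurs squared up to sign. So the following
  polynomial is divisible by high powers of all differences but \<open>X k - X l\<close>, and only the
  transposition of \<open>k\<close> and \<open>l\<close> imposes a condition on a cofactor \<open>f\<close> for membership in \<open>QI n m\<close>.\<close>

definition other_pairs :: "nat \<Rightarrow> nat \<Rightarrow> nat \<Rightarrow> (nat \<times> nat) set" where
  "other_pairs n k l = {(a, b) \<in> distinct_pairs n. {a, b} \<noteq> {k, l}}"

definition test_poly :: "nat \<Rightarrow> nat \<Rightarrow> nat \<Rightarrow> nat \<Rightarrow> rpoly" where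
  "test_poly n m k l = prod diff (other_pairs n k l) ^ (m + 1)"

lemma finite_other_pairs [simp]: "finite (other_pairs n k l)"
  by (rule finite_subset[of _ "distinct_pairs n"]) (auto simp: other_pairs_def)

lemma other_pairs_permutes:
  assumes "\<pi> permutes {1..n}"
  shows "bij_betw (map_prod \<pi> \<pi>) (other_pairs n k l) (other_pairs n (\<pi> k) (\<pi> l))"
proof -
  have "inj \<pi>" using permutes_inj[OF assms] .
  then have "map_prod \<pi> \<pi> ` other_pairs n k l = other_pairs n (\<pi> k) (\<pi> l)"
    using bij_betw_imp_surj_on[OF distinct_pairs_permutes[OF assms]]
    by (fastforce simp: other_pairs_def doubleton_eq_iff image_iff inj_eq)
  moreover have "inj_on (map_prod \<pi> \<pi>) (other_pairs n k l)"
    using \<open>inj \<pi>\<close> by (auto simp: inj_on_def dest: injD)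
  ultimately show ?thesis by (simp add: bij_betw_def)
qed

lemma perm_act_test_poly:
  assumes "\<pi> permutes {1..n}"
  shows "perm_act \<pi> (test_poly n m k l) = test_poly n m (\<pi> k) (\<pi> l)"
proof -
  have "perm_act \<pi> (prod diff (other_pairs n k l))
      = (\<Prod>p\<in>other_pairs n k l. diff (map_prod \<pi> \<pi> p))"
    by (simp add: perm_act.hom_prod split_beta hom_distribs)
  also have "\<dots> = prod diff (other_pairs n (\<pi> k) (\<pi> l))"
    using prod.reindex_bij_betw[OF other_pairs_permutes[OF assms]] .
  finally show ?thesis by (simp add: test_poly_def hom_distribs)
qed

lemma diff_power_dvd_test_poly:
  assumes "(a, b) \<in> distinct_pairs n" "{a, b} \<noteq> {k, l}"
  shows "(X a - X b) ^ (2 * m + 1) dvd test_poly n m k l"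
proof -
  have sub: "{(a, b), (b, a)} \<subseteq> other_pairs n k l"
    using assms by (auto simp: other_pairs_def distinct_pairs_def)
  have ab: "a \<noteq> b" using assms by (auto simp: distinct_pairs_def)
  have "prod diff {(a, b), (b, a)} dvd prod diff (other_pairs n k l)"
    using sub by (intro prod_dvd_prod_subset) auto
  moreover have "prod diff {(a, b), (b, a)} = - ((X a - X b) ^ 2)"
    using ab by (simp add: power2_eq_square algebra_simps)
  ultimately have "(X a - X b) ^ 2 dvd prod diff (other_pairs n k l)" by simp
  then have "((X a - X b) ^ 2) ^ (m + 1) dvd test_poly n m k l"
    unfolding test_poly_def by (rule dvd_power_same)
  moreover have "(X a - X b) ^ (2 * m + 1) dvd ((X a - X b) ^ 2) ^ (m + 1)"
    unfolding power_mult[symmetric] by (intro le_imp_power_dvd) simp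
  ultimately show ?thesis by (rule dvd_trans[rotated])
qed

text \<open>By primality the product vanishes on the hyperplane x_i = x_j only if one of its factors
  is \<open>X i - X j\<close> up to sign. So each test polynomial singles out one
  hyperplane.\<close>

lemma merge_test_poly:
  assumes "(i, j) \<in> distinct_pairs n"
  shows "merge i j (test_poly n m k l) = 0 \<longleftrightarrow> {i, j} \<noteq> {k, l}"
proof
  assume "{i, j} \<noteq> {k, l}"
  then have "X i - X j dvd test_poly n m k l"
    using diff_power_dvd_test_poly[OF assms] by (metis dvd_mult_left power_Suc Suc_eq_plus1)
  then show "merge i j (test_poly n m k l) = 0" by (simp add: merge_eq_0_iff)
next
  have ij: "i \<noteq> j" using assms by (simp add: distinct_pairs_def)
  assume "merge i j (test_poly n m k l) = 0"
  then have "X i - X j dvd prod diff (other_pairs n k l)"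
    unfolding merge_eq_0_iff test_poly_def using prime_elem_dvd_power[OF prime_elem_diff[OF ij]] by blast
  from prime_elem_dvd_prod[OF finite_other_pairs prime_elem_diff[OF ij] this]
  obtain p where p: "p \<in> other_pairs n k l" "X i - X j dvd diff p" by blast
  obtain a b where "p = (a, b)" by (cases p)
  with p have ab: "(a, b) \<in> other_pairs n k l" "X i - X j dvd X a - X b" by auto
  then have "{a, b} = {i, j}"
    using diff_dvd_diff_iff[OF ij, of a b] by (auto simp: other_pairs_def distinct_pairs_def)
  then show "{i, j} \<noteq> {k, l}" using ab(1) by (auto simp: other_pairs_def)
qed

lemma QI_test_poly_mult:
  assumes "n \<ge> 1" "(k, l) \<in> distinct_pairs n" "f \<in> poly_ring n"
    "perm_act (Transposition.transpose k l) f = f"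
  shows "test_poly n m k l * f \<in> QI n m"
  unfolding QI_iff_pairs[OF assms(1)]
proof safe
  have "test_poly n m k l \<in> poly_ring n"
  proof -
    have "other_pairs n k l \<subseteq> distinct_pairs n" by (auto simp: other_pairs_def)
    from prod_diff_poly_ring[OF assms(1) this] show ?thesis
      using assms(1) by (simp only: poly_ring_iff test_poly_def perm_act.hom_power)
  qed
  then show "test_poly n m k l * f \<in> poly_ring n" using assms by (intro poly_ring_mult)
  fix i j assume ij: "(i, j) \<in> distinct_pairs n"
  let ?s = "perm_act (Transposition.transpose i j)"
  let ?t = "Transposition.transpose i j"
  have E: "?s (test_poly n m k l) = test_poly n m (?t k) (?t l)"
    using perm_act_test_poly[OF transpose_permutes[OF ij]] .
  show "(X i - X j) ^ (2 * m + 1) dvd test_poly n m k l * f - ?s (test_poly n m k l * f)"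
  proof (cases "{i, j} = {k, l}")
    case True
    then have "?t = Transposition.transpose k l"
      by (auto simp: doubleton_eq_iff transpose_commute)
    moreover have "test_poly n m l k = test_poly n m k l"
      by (simp add: test_poly_def other_pairs_def insert_commute)
    ultimately show ?thesis using E assms(4) by (simp add: perm_act.hom_mult)
  next
    case False
    \<comment> \<open>The transposition preserves {i, j}, so it cannot move {k, l} onto it; both
      terms of the difference are then divisible separately.\<close>
    then have "{i, j} \<noteq> {?t k, ?t l}"
      by (auto simp: Transposition.transpose_def doubleton_eq_iff split: if_splits)
    then show ?thesis unfolding perm_act.hom_mult E
      using False ij by (intro dvd_diff dvd_mult2 diff_power_dvd_test_poly)
  qed
qed

section \<open>Independence of characters\<close>

text \<open>Dedekind's argument on a multiplicatively closed set M that contains 1: a point y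
  separating two characters shortens the relation.\<close>

lemma dedekind_independence:
  fixes \<chi> :: "'b \<Rightarrow> 'a::monoid_mult \<Rightarrow> 'c::idom"
  assumes "finite I"
    and M: "1 \<in> M" "\<And>x y. x \<in> M \<Longrightarrow> y \<in> M \<Longrightarrow> x * y \<in> M"
    and \<chi>: "\<And>i. i \<in> I \<Longrightarrow> \<chi> i 1 = 1"
      "\<And>i x y. i \<in> I \<Longrightarrow> x \<in> M \<Longrightarrow> y \<in> M \<Longrightarrow> \<chi> i (x * y) = \<chi> i x * \<chi> i y"
    and distinct: "\<And>i j. i \<in> I \<Longrightarrow> j \<in> I \<Longrightarrow> i \<noteq> j \<Longrightarrow> \<exists>x\<in>M. \<chi> i x \<noteq> \<chi> j x"
    and dep: "\<And>x. x \<in> M \<Longrightarrow> (\<Sum>i\<in>I. c i * \<chi> i x) = 0"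
    and "i \<in> I"
  shows "c i = 0"
  using assms(1) \<chi> distinct dep \<open>i \<in> I\<close>
proof (induction I arbitrary: c i)
  case (insert k I)
  have c0: "c j = 0" if j: "j \<in> I" for j
  proof -
    obtain y where y: "y \<in> M" "\<chi> j y \<noteq> \<chi> k y"
      using insert.prems(3)[of j k] insert.hyps(2) j by blast
    have "c j * (\<chi> j y - \<chi> k y) = 0"
    proof (rule insert.IH[where c = "\<lambda>j. c j * (\<chi> j y - \<chi> k y)"])
      fix x assume x: "x \<in> M"
      \<comment> \<open>The relation at x * y minus \<open>\<chi> k y\<close> times the relation at
        x: the term of k drops out.\<close>
      have "(\<Sum>i\<in>insert k I. c i * \<chi> i (x * y)) - (\<Sum>i\<in>insert k I. c i * \<chi> i x) * \<chi> k y = 0"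
        using insert.prems(4) M(2)[OF x y(1)] x by simp
      also have "(\<Sum>i\<in>insert k I. c i * \<chi> i (x * y)) - (\<Sum>i\<in>insert k I. c i * \<chi> i x) * \<chi> k y
          = (\<Sum>i\<in>insert k I. c i * (\<chi> i y - \<chi> k y) * \<chi> i x)"
        unfolding sum_distrib_right sum_subtractf[symmetric]
        using insert.prems(2) x y(1) by (intro sum.cong) (auto simp: algebra_simps)
      finally show "(\<Sum>i\<in>I. c i * (\<chi> i y - \<chi> k y) * \<chi> i x) = 0"
        using insert.hyps by simp
    qed (use insert.prems j in auto)
    then show ?thesis using y(2) by simp
  qed
  have "c k = 0"
    using insert.prems(4)[OF M(1)] insert.prems(1)[of k] insert.hyps c0 by simp
  then show ?case using c0 insert.prems(5) by blast
qed simp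

section \<open>Permutations as characters modulo a difference of variables\<close>

definition perms :: "nat \<Rightarrow> (nat \<Rightarrow> nat) set" where
  "perms n = {\<pi>. \<pi> permutes {1..n}}"

text \<open>\<open>\<sigma>\<close> and \<open>Transposition.transpose i j \<circ> \<sigma>\<close> agree after merging \<open>i\<close> and \<open>j\<close>; being ascending picks one
  permutation of each such pair.\<close>

definition ascending :: "nat \<Rightarrow> nat \<Rightarrow> (nat \<Rightarrow> nat) \<Rightarrow> bool" where
  "ascending i j \<sigma> \<longleftrightarrow> inv_into UNIV \<sigma> i < inv_into UNIV \<sigma> j"

text \<open>Let k, l be the preimages of i, j under \<open>\<sigma>\<close>. The test polynomial of
  k, l survives \<open>\<sigma>\<close> and merging; it dies under \<open>\<tau>\<close> unless
  \<open>\<tau>\<close> maps {k, l} to {i, j}. In that case equal orientation makes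
  \<open>\<tau>\<close> agree with \<open>\<sigma>\<close> on k and l, and an extra factor
  \<open>X r\<close> with r outside {k, l} separates them.\<close>

lemma separating_poly:
  assumes n: "n \<ge> 1" and ij: "(i, j) \<in> distinct_pairs n"
    and \<sigma>: "\<sigma> \<in> perms n" and \<tau>: "\<tau> \<in> perms n" and "\<sigma> \<noteq> \<tau>"
    and asc: "ascending i j \<sigma> \<longleftrightarrow> ascending i j \<tau>"
  shows "\<exists>P\<in>QI n m. merge i j (perm_act \<sigma> P) \<noteq> merge i j (perm_act \<tau> P)"
proof -
  have \<sigma>: "\<sigma> permutes {1..n}" and \<tau>: "\<tau> permutes {1..n}"
    using \<sigma> \<tau> by (auto simp: perms_def)
  define k l where "k = inv_into UNIV \<sigma> i" and "l = inv_into UNIV \<sigma> j"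
  have \<sigma>kl: "\<sigma> k = i" "\<sigma> l = j"
    using permutes_inverses[OF \<sigma>] by (auto simp: k_def l_def)
  have kl: "(k, l) \<in> distinct_pairs n"
    using bij_betwE[OF distinct_pairs_permutes[OF permutes_inv[OF \<sigma>]]] ij
    by (force simp: k_def l_def)
  let ?E = "test_poly n m k l"
  have E\<sigma>: "merge i j (perm_act \<sigma> ?E) \<noteq> 0"
    using merge_test_poly[OF ij] by (simp add: perm_act_test_poly[OF \<sigma>] \<sigma>kl)
  show ?thesis
  proof (cases "{\<tau> k, \<tau> l} = {i, j}")
    case False
    then have "merge i j (perm_act \<tau> ?E) = 0"
      using merge_test_poly[OF ij] not_sym[OF False] by (simp add: perm_act_test_poly[OF \<tau>])
    moreover have "?E * 1 \<in> QI n m"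
      by (rule QI_test_poly_mult[OF n kl poly_ring_1]) simp
    ultimately show ?thesis using E\<sigma> by (intro bexI[of _ ?E]) auto
  next
    case True
    have \<tau>kl: "\<tau> k = i" "\<tau> l = j"
    proof -
      \<comment> \<open>Exchanged preimages would reverse their order, against
        \<open>asc\<close>.\<close>
      have "\<not> (\<tau> k = j \<and> \<tau> l = i)"
      proof
        assume "\<tau> k = j \<and> \<tau> l = i"
        then have "inv_into UNIV \<tau> j = k" "inv_into UNIV \<tau> i = l"
          using permutes_inv_eq[OF \<tau>] by auto
        then show False using asc kl by (auto simp: ascending_def distinct_pairs_def k_def l_def)
      qed
      then show "\<tau> k = i" "\<tau> l = j" using True by (auto simp: doubleton_eq_iff)
    qed
    obtain r where r: "\<sigma> r \<noteq> \<tau> r" using \<open>\<sigma> \<noteq> \<tau>\<close> by auto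
    have rn: "r \<in> {1..n}"
      using r permutes_not_in[OF \<sigma>] permutes_not_in[OF \<tau>] by metis
    have rkl: "r \<noteq> k" "r \<noteq> l" using r \<sigma>kl \<tau>kl by auto
    \<comment> \<open>Only j is moved by \<open>collapse i j\<close>, so the two images of
      \<open>X r\<close> stay distinct after merging.\<close>
    have ne: "\<sigma> r \<noteq> j" "\<tau> r \<noteq> j"
      using rkl \<sigma>kl \<tau>kl permutes_inj[OF \<sigma>] permutes_inj[OF \<tau>] by (metis injD)+
    have "?E * X r \<in> QI n m"
      by (rule QI_test_poly_mult[OF n kl poly_ring_X[OF rn]])
        (use rkl in \<open>simp add: Transposition.transpose_def\<close>)
    moreover have "merge i j (perm_act \<sigma> (?E * X r)) \<noteq> merge i j (perm_act \<tau> (?E * X r))"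
    proof -
      have "merge i j (perm_act \<tau> ?E) = merge i j (perm_act \<sigma> ?E)"
        by (simp add: perm_act_test_poly[OF \<sigma>] perm_act_test_poly[OF \<tau>] \<sigma>kl \<tau>kl)
      then show ?thesis using E\<sigma> ne r by (simp add: perm_act.hom_mult collapse_def)
    qed
    ultimately show ?thesis by blast
  qed
qed

lemma perm_act_characters_independent:
  assumes n: "n \<ge> 1" and ij: "(i, j) \<in> distinct_pairs n"
    and A: "A \<subseteq> perms n" "\<And>\<sigma> \<tau>. \<sigma> \<in> A \<Longrightarrow> \<tau> \<in> A \<Longrightarrow> ascending i j \<sigma> \<longleftrightarrow> ascending i j \<tau>"
    and dep: "\<And>P. P \<in> QI n m \<Longrightarrow> (\<Sum>\<sigma>\<in>A. c \<sigma> * merge i j (perm_act \<sigma> P)) = 0"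
    and "\<sigma> \<in> A"
  shows "c \<sigma> = 0"
proof (rule dedekind_independence[where M = "QI n m" and I = A and c = c and i = \<sigma> and \<chi> = "\<lambda>\<sigma> P. merge i j (perm_act \<sigma> P)"])
  show "finite A"
    using A(1) finite_permutations[of "{1..n}"] by (auto simp: perms_def intro: finite_subset)
  show "\<exists>P\<in>QI n m. merge i j (perm_act \<sigma> P) \<noteq> merge i j (perm_act \<tau> P)"
    if "\<sigma> \<in> A" "\<tau> \<in> A" "\<sigma> \<noteq> \<tau>" for \<sigma> \<tau>
    using separating_poly[OF n ij _ _ that(3) A(2)[OF that(1,2)]] A(1) that(1,2) by blast
qed (use assms in \<open>auto simp: QI_1 QI_mult perm_act.hom_mult\<close>)

section \<open>Coordinates along a reflection hyperplane\<close>

text \<open>The quotient exists for \<open>P \<in> QI n m\<close>; outside of \<open>QI n m\<close> the value is arbitrary.\<close>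

definition skew_part :: "nat \<Rightarrow> nat \<Rightarrow> nat \<Rightarrow> (nat \<Rightarrow> nat) \<Rightarrow> rpoly \<Rightarrow> rpoly" where
  "skew_part i j m \<sigma> P = (SOME w. perm_act \<sigma> P - perm_act (Transposition.transpose i j \<circ> \<sigma>) P
     = (X i - X j) ^ (2 * m + 1) * w)"

text \<open>As for one reflection, where the pair f(x), f(-x) is traded for f(x) and (f(x) - f(-x))
  / x^(2m+1): each pair of permutations related by the transposition keeps one value and one divided
  difference.\<close>

definition local_coord :: "nat \<Rightarrow> nat \<Rightarrow> nat \<Rightarrow> (nat \<Rightarrow> nat) \<Rightarrow> rpoly \<Rightarrow> rpoly" where
  "local_coord i j m \<sigma> P = (if ascending i j \<sigma> then perm_act \<sigma> P else skew_part i j m \<sigma> P)"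

lemma skew_part_eqI:
  assumes "i \<noteq> j"
    "perm_act \<sigma> P - perm_act (Transposition.transpose i j \<circ> \<sigma>) P = (X i - X j) ^ (2 * m + 1) * w"
  shows "skew_part i j m \<sigma> P = w"
proof -
  have "perm_act \<sigma> P - perm_act (Transposition.transpose i j \<circ> \<sigma>) P
      = (X i - X j) ^ (2 * m + 1) * skew_part i j m \<sigma> P"
    unfolding skew_part_def by (rule someI) (rule assms(2))
  from trans[OF this[symmetric] assms(2)]
  have "(X i - X j) ^ (2 * m + 1) * skew_part i j m \<sigma> P = (X i - X j) ^ (2 * m + 1) * w" .
  moreover have "(X i - X j) ^ (2 * m + 1) \<noteq> 0" using assms(1) by simp
  ultimately show ?thesis using mult_left_cancel by blast
qed

text \<open>Conjugation: with k, l the preimages of i, j, the transposition of i and j after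
  \<open>\<sigma>\<close> equals \<open>\<sigma>\<close> after that of k and l. Applying
  \<open>\<sigma>\<close> to the condition for k, l gives the quotient.\<close>

lemma skew_part:
  assumes n: "n \<ge> 1" and ij: "(i, j) \<in> distinct_pairs n" and "\<sigma> \<in> perms n" and P: "P \<in> QI n m"
  shows "perm_act \<sigma> P - perm_act (Transposition.transpose i j \<circ> \<sigma>) P
    = (X i - X j) ^ (2 * m + 1) * skew_part i j m \<sigma> P"
proof -
  have \<sigma>: "\<sigma> permutes {1..n}" using assms(3) by (simp add: perms_def)
  define k l where "k = inv_into UNIV \<sigma> i" and "l = inv_into UNIV \<sigma> j"
  have \<sigma>kl: "\<sigma> k = i" "\<sigma> l = j"
    using permutes_inverses[OF \<sigma>] by (auto simp: k_def l_def)
  have kl: "(k, l) \<in> distinct_pairs n"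
    using bij_betwE[OF distinct_pairs_permutes[OF permutes_inv[OF \<sigma>]]] ij
    by (force simp: k_def l_def)
  have comm: "\<sigma> \<circ> Transposition.transpose k l = Transposition.transpose i j \<circ> \<sigma>"
    using permutes_inj[OF \<sigma>] \<sigma>kl
    by (auto simp: fun_eq_iff Transposition.transpose_def dest: injD)
  obtain Q where Q: "P - perm_act (Transposition.transpose k l) P = (X k - X l) ^ (2 * m + 1) * Q"
    using P kl unfolding QI_iff_pairs[OF n] by (fast elim: dvdE)
  have "perm_act \<sigma> P - perm_act (Transposition.transpose i j \<circ> \<sigma>) P
      = (X i - X j) ^ (2 * m + 1) * perm_act \<sigma> Q"
    using arg_cong[OF Q, of "perm_act \<sigma>"]
    by (simp only: perm_act.hom_minus perm_act.hom_mult perm_act.hom_power perm_act_X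
        perm_act_comp comm \<sigma>kl)
  then show ?thesis unfolding skew_part_def by (rule someI)
qed

lemma perms_sym_polys: "\<sigma> \<in> perms n \<Longrightarrow> c \<in> sym_polys n \<Longrightarrow> perm_act \<sigma> c = c"
  by (auto simp: perms_def sym_polys_def)

lemma perms_transpose:
  "(i, j) \<in> distinct_pairs n \<Longrightarrow> \<sigma> \<in> perms n \<Longrightarrow> Transposition.transpose i j \<circ> \<sigma> \<in> perms n"
  unfolding perms_def mem_Collect_eq by (intro permutes_compose transpose_permutes)

text \<open>Permutations fix symmetric coefficients, which therefore pass through values and divided
  differences alike. This is what lets B act on coordinates by matrix multiplication.\<close>

lemma local_coord_sum:
  assumes n: "n \<ge> 1" and ij: "(i, j) \<in> distinct_pairs n" and \<sigma>: "\<sigma> \<in> perms n"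
    and c: "\<And>t. t \<in> A \<Longrightarrow> c t \<in> sym_polys n" and b: "\<And>t. t \<in> A \<Longrightarrow> b t \<in> QI n m"
  shows "local_coord i j m \<sigma> (\<Sum>t\<in>A. c t * b t) = (\<Sum>t\<in>A. c t * local_coord i j m \<sigma> (b t))"
proof -
  let ?s\<sigma> = "Transposition.transpose i j \<circ> \<sigma>"
  have lin: "perm_act \<pi> (\<Sum>t\<in>A. c t * b t) = (\<Sum>t\<in>A. c t * perm_act \<pi> (b t))"
    if "\<pi> \<in> perms n" for \<pi>
    unfolding perm_act.hom_sum perm_act.hom_mult
    by (intro sum.cong refl) (simp add: c perms_sym_polys[OF that])
  show ?thesis
  proof (cases "ascending i j \<sigma>")
    case True
    then show ?thesis using lin[OF \<sigma>] by (simp add: local_coord_def)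
  next
    case False
    have "perm_act \<sigma> (\<Sum>t\<in>A. c t * b t) - perm_act ?s\<sigma> (\<Sum>t\<in>A. c t * b t)
        = (\<Sum>t\<in>A. c t * (perm_act \<sigma> (b t) - perm_act ?s\<sigma> (b t)))"
      unfolding lin[OF \<sigma>] lin[OF perms_transpose[OF ij \<sigma>]]
      by (simp only: right_diff_distrib sum_subtractf)
    also have "\<dots> = (X i - X j) ^ (2 * m + 1) * (\<Sum>t\<in>A. c t * skew_part i j m \<sigma> (b t))"
      unfolding sum_distrib_left
      by (intro sum.cong refl) (simp only: skew_part[OF n ij \<sigma> b] mult.left_commute)
    finally show ?thesis
      using False ij by (simp add: local_coord_def skew_part_eqI distinct_pairs_def)
  qed
qed

lemma local_coord_Suc:
  assumes n: "n \<ge> 1" and ij: "(i, j) \<in> distinct_pairs n" and \<sigma>: "\<sigma> \<in> perms n"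
    and P: "P \<in> QI n (m + 1)"
  shows "local_coord i j m \<sigma> P
    = local_coord i j (m + 1) \<sigma> P * (if ascending i j \<sigma> then 1 else (X i - X j) ^ 2)"
proof (cases "ascending i j \<sigma>")
  case False
  have "perm_act \<sigma> P - perm_act (Transposition.transpose i j \<circ> \<sigma>) P
    = (X i - X j) ^ (2 * m + 1) * (skew_part i j (m + 1) \<sigma> P * (X i - X j) ^ 2)"
    unfolding skew_part[OF n ij \<sigma> P] by (simp add: algebra_simps power2_eq_square)
  from skew_part_eqI[OF _ this] show ?thesis
    using False ij by (simp add: local_coord_def distinct_pairs_def)
qed (simp add: local_coord_def)

lemma ascending_transpose:
  assumes "(i, j) \<in> distinct_pairs n" "\<sigma> \<in> perms n"
  shows "ascending i j (Transposition.transpose i j \<circ> \<sigma>) \<longleftrightarrow> \<not> ascending i j \<sigma>"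
proof -
  let ?s\<sigma> = "Transposition.transpose i j \<circ> \<sigma>"
  have \<sigma>: "\<sigma> permutes {1..n}" and s\<sigma>: "?s\<sigma> permutes {1..n}"
    using assms perms_transpose by (auto simp: perms_def)
  have "inv_into UNIV ?s\<sigma> i = inv_into UNIV \<sigma> j" "inv_into UNIV ?s\<sigma> j = inv_into UNIV \<sigma> i"
    unfolding permutes_inv_eq[OF s\<sigma>] using permutes_inverses[OF \<sigma>] by auto
  moreover have "inv_into UNIV \<sigma> i \<noteq> inv_into UNIV \<sigma> j"
    using assms(1) permutes_inj[OF permutes_inv[OF \<sigma>]] by (auto simp: distinct_pairs_def dest: injD)
  ultimately show ?thesis by (auto simp: ascending_def)
qed

lemma finite_perms [simp]: "finite (perms n)"
  by (simp add: perms_def finite_permutations)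

lemma card_perms: "card (perms n) = fact n"
  by (simp add: perms_def card_permutations)

text \<open>Composition with the transposition exchanges the two classes. The doubled form is the
  exponent obtained from one factor \<open>(X i - X j) ^ 2\<close> per descending
  permutation.\<close>

lemma card_descending:
  assumes ij: "(i, j) \<in> distinct_pairs n"
  shows "2 * card {\<sigma> \<in> perms n. \<not> ascending i j \<sigma>} = fact n"
proof -
  let ?A = "{\<sigma> \<in> perms n. ascending i j \<sigma>}" and ?D = "{\<sigma> \<in> perms n. \<not> ascending i j \<sigma>}"
  have "bij_betw ((\<circ>) (Transposition.transpose i j)) ?A ?D"
    using perms_transpose[OF ij] ascending_transpose[OF ij]
    by (intro bij_betw_byWitness[where f' = "(\<circ>) (Transposition.transpose i j)"])
      (auto simp flip: o_assoc simp: o_assoc)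
  then have "card ?A = card ?D" by (rule bij_betw_same_card)
  moreover have "perms n = ?A \<union> ?D" by auto
  then have "card (perms n) = card ?A + card ?D"
    by (metis (no_types, lifting) card_Un_disjoint disjoint_iff finite_Un finite_perms mem_Collect_eq)
  ultimately show ?thesis by (simp add: card_perms)
qed

lemma merge_perm_act_vandermonde:
  assumes "(i, j) \<in> distinct_pairs n" "\<sigma> \<in> perms n"
  shows "merge i j (perm_act \<sigma> (vandermonde n)) = 0"
  using perm_act_vandermonde[of \<sigma> n] assms diff_dvd_vandermonde[of i j n]
  by (auto simp: merge_eq_0_iff perms_def)

text \<open>An odd power of the Vandermonde product is antisymmetric, so the difference defining the
  skew part becomes a sum of two images of Q. They coincide after merging; the multiplier is 2 times
  a power of the merged cofactor, up to sign.\<close>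

lemma merge_local_coord_vandermonde:
  assumes n: "n \<ge> 1" and ij: "(i, j) \<in> pairs n" and \<sigma>: "\<sigma> \<in> perms n" "\<not> ascending i j \<sigma>"
  shows "\<exists>\<kappa>. \<kappa> \<noteq> 0 \<and> (\<forall>Q. merge i j (local_coord i j m \<sigma> (vandermonde n ^ (2 * m + 1) * Q))
    = \<kappa> * merge i j (perm_act \<sigma> Q))"
proof -
  let ?s = "Transposition.transpose i j" and ?k = "2 * m + 1"
  obtain Y where Y: "vandermonde n = (X i - X j) * Y" "merge i j Y \<noteq> 0"
    by (rule vandermonde_cofactor[OF ij])
  have "\<exists>\<epsilon> :: rpoly. (\<epsilon> = 1 \<or> \<epsilon> = - 1) \<and> perm_act \<sigma> (vandermonde n) = \<epsilon> * vandermonde n"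
    using perm_act_vandermonde[of \<sigma> n] \<sigma>(1) by (auto simp: perms_def intro: exI[of _ "- 1"])
  then obtain \<epsilon> where \<epsilon>: "\<epsilon> = 1 \<or> \<epsilon> = - 1" "perm_act \<sigma> (vandermonde n) = \<epsilon> * vandermonde n"
    by blast
  have \<epsilon>s: "perm_act \<pi> \<epsilon> = \<epsilon>" for \<pi> using \<epsilon>(1) by (auto simp: hom_distribs)
  have s: "perm_act (?s \<circ> \<sigma>) (vandermonde n) = - (\<epsilon> * vandermonde n)"
    unfolding perm_act_comp[symmetric] \<epsilon>(2) perm_act.hom_mult \<epsilon>s
      perm_act_transpose_vandermonde[OF ij] by simp
  have "skew_part i j m \<sigma> (vandermonde n ^ ?k * Q)
      = (\<epsilon> * Y) ^ ?k * (perm_act \<sigma> Q + perm_act (?s \<circ> \<sigma>) Q)" for Q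
  proof (rule skew_part_eqI)
    show "i \<noteq> j" using ij by (auto simp: pairs_def)
    have "perm_act \<sigma> (vandermonde n ^ ?k * Q) - perm_act (?s \<circ> \<sigma>) (vandermonde n ^ ?k * Q)
        = (\<epsilon> * vandermonde n) ^ ?k * perm_act \<sigma> Q - (- (\<epsilon> * vandermonde n)) ^ ?k * perm_act (?s \<circ> \<sigma>) Q"
      by (simp only: perm_act.hom_mult perm_act.hom_power \<epsilon>(2) s)
    also have "\<dots> = (\<epsilon> * vandermonde n) ^ ?k * (perm_act \<sigma> Q + perm_act (?s \<circ> \<sigma>) Q)"
      by (simp add: algebra_simps)
    also have "\<dots> = (X i - X j) ^ ?k * ((\<epsilon> * Y) ^ ?k * (perm_act \<sigma> Q + perm_act (?s \<circ> \<sigma>) Q))"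
      unfolding Y(1) by (simp only: power_mult_distrib mult_ac)
    finally show "perm_act \<sigma> (vandermonde n ^ ?k * Q) - perm_act (?s \<circ> \<sigma>) (vandermonde n ^ ?k * Q)
        = (X i - X j) ^ ?k * ((\<epsilon> * Y) ^ ?k * (perm_act \<sigma> Q + perm_act (?s \<circ> \<sigma>) Q))" .
  qed
  then have "merge i j (local_coord i j m \<sigma> (vandermonde n ^ ?k * Q))
      = (2 * (\<epsilon> * merge i j Y) ^ ?k) * merge i j (perm_act \<sigma> Q)" for Q
    using \<sigma>(2)
    by (simp only: local_coord_def if_False perm_act.hom_mult perm_act.hom_power perm_act.hom_add
        \<epsilon>s merge_transpose mult_2 distrib_left distrib_right)
  moreover have "2 * (\<epsilon> * merge i j Y) ^ ?k \<noteq> 0" using Y(2) \<epsilon>(1) by auto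
  ultimately show ?thesis by blast
qed

text \<open>On \<open>vandermonde n ^ (2 * m + 1) * Q\<close> the ascending coordinates vanish modulo \<open>X i - X j\<close> and the
  others are nonzero multiples of the characters \<open>perm_act \<sigma> Q\<close>, so both halves of a relation can be
  killed by independence of characters.\<close>

lemma local_coord_independent:
  assumes n: "n \<ge> 1" and ij: "(i, j) \<in> pairs n"
    and dep: "\<And>P. P \<in> QI n m \<Longrightarrow> (\<Sum>\<sigma>\<in>perms n. v \<sigma> * merge i j (local_coord i j m \<sigma> P)) = 0"
    and "\<sigma> \<in> perms n"
  shows "v \<sigma> = 0"
proof -
  have ij': "(i, j) \<in> distinct_pairs n" using ij pairs_subset by blast
  let ?A = "{\<sigma> \<in> perms n. ascending i j \<sigma>}" and ?D = "{\<sigma> \<in> perms n. \<not> ascending i j \<sigma>}"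
  have split: "(\<Sum>\<sigma>\<in>perms n. f \<sigma>) = (\<Sum>\<sigma>\<in>?A. f \<sigma>) + (\<Sum>\<sigma>\<in>?D. f \<sigma>)" for f :: "_ \<Rightarrow> rpoly"
    by (subst sum.union_disjoint[symmetric]) (auto intro: arg_cong[where f = "sum f"])
  have "\<forall>\<sigma>\<in>?D. \<exists>\<kappa>. \<kappa> \<noteq> 0 \<and>
      (\<forall>Q. merge i j (local_coord i j m \<sigma> (vandermonde n ^ (2 * m + 1) * Q))
        = \<kappa> * merge i j (perm_act \<sigma> Q))"
    using merge_local_coord_vandermonde[OF n ij] by blast
  then obtain \<kappa> where \<kappa>: "\<And>\<sigma>. \<sigma> \<in> ?D \<Longrightarrow> \<kappa> \<sigma> \<noteq> 0"
    "\<And>\<sigma> Q. \<sigma> \<in> ?D \<Longrightarrow> merge i j (local_coord i j m \<sigma> (vandermonde n ^ (2 * m + 1) * Q))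
        = \<kappa> \<sigma> * merge i j (perm_act \<sigma> Q)"
    by (metis (no_types, lifting) bchoice)
  have D: "v \<sigma> = 0" if \<sigma>: "\<sigma> \<in> ?D" for \<sigma>
  proof -
    have "v \<sigma> * \<kappa> \<sigma> = 0"
    proof (rule perm_act_characters_independent[where c = "\<lambda>\<sigma>. v \<sigma> * \<kappa> \<sigma>", OF n ij' _ _ _ \<sigma>])
      fix Q assume Q: "Q \<in> QI n m"
      have "merge i j (local_coord i j m \<sigma> (vandermonde n ^ (2 * m + 1) * Q)) = 0" if "\<sigma> \<in> ?A" for \<sigma>
        using that merge_perm_act_vandermonde[OF ij', of \<sigma>]
        by (simp add: local_coord_def perm_act.hom_mult perm_act.hom_power)
      then have "0 = (\<Sum>\<sigma>\<in>?D. v \<sigma> * merge i j (local_coord i j m \<sigma> (vandermonde n ^ (2 * m + 1) * Q)))"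
        using dep[OF QI_mult[OF n QI_vandermonde_power[OF n] Q]] unfolding split by simp
      also have "\<dots> = (\<Sum>\<sigma>\<in>?D. v \<sigma> * \<kappa> \<sigma> * merge i j (perm_act \<sigma> Q))"
        using \<kappa>(2) by (intro sum.cong refl) (simp only: mult.assoc)
      finally show "(\<Sum>\<sigma>\<in>?D. v \<sigma> * \<kappa> \<sigma> * merge i j (perm_act \<sigma> Q)) = 0" by simp
    qed auto
    then show ?thesis using \<kappa>(1)[OF \<sigma>] by simp
  qed
  have A: "v \<sigma> = 0" if \<sigma>: "\<sigma> \<in> ?A" for \<sigma>
  proof (rule perm_act_characters_independent[where c = v, OF n ij' _ _ _ \<sigma>])
    fix P assume P: "P \<in> QI n m"
    have "(\<Sum>\<sigma>\<in>?A. v \<sigma> * merge i j (local_coord i j m \<sigma> P)) = 0"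
      using dep[OF P] D unfolding split by simp
    then show "(\<Sum>\<sigma>\<in>?A. v \<sigma> * merge i j (perm_act \<sigma> P)) = 0"
      by (simp add: local_coord_def cong: sum.cong_simp conj_cong)
  qed auto
  show ?thesis using A D assms(4) by blast
qed

section \<open>The determinant of the base change\<close>

text \<open>Rows belong to basis elements and columns to permutations: base change multiplies from
  the left, rescaling of coordinates from the right.\<close>

definition coord_mat :: "nat \<Rightarrow> nat \<Rightarrow> nat \<Rightarrow> nat \<Rightarrow> (nat \<Rightarrow> nat \<Rightarrow> nat) \<Rightarrow> (nat \<Rightarrow> rpoly) \<Rightarrow> rpoly mat"
  where "coord_mat n i j m e b = mat (fact n) (fact n) (\<lambda>(t, k). local_coord i j m (e k) (b t))"

lemma coord_mat_carrier [simp]: "coord_mat n i j m e b \<in> carrier_mat (fact n) (fact n)"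
  by (simp add: coord_mat_def)

text \<open>A determinant vanishing modulo \<open>X i - X j\<close> gives a kernel vector, that is,
  a relation between the coordinates that holds on the basis. Since the basis spans, the relation
  holds on all of \<open>QI n m\<close>, against independence.\<close>

lemma det_coord_mat:
  assumes n: "n \<ge> 1" and ij: "(i, j) \<in> pairs n"
    and e: "bij_betw e {..<fact n} (perms n)"
    and b: "is_sym_basis n (QI n m) (fact n) b"
  shows "\<not> X i - X j dvd det (coord_mat n i j m e b)"
proof
  let ?N = "fact n :: nat" and ?M = "map_mat (merge i j) (coord_mat n i j m e b)"
  have ij': "(i, j) \<in> distinct_pairs n" using ij pairs_subset by blast
  have M: "?M \<in> carrier_mat ?N ?N" by simp
  assume "X i - X j dvd det (coord_mat n i j m e b)"
  then have "det ?M = 0" by (simp add: merge_eq_0_iff)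
  then obtain v where v: "v \<in> carrier_vec ?N" "v \<noteq> 0\<^sub>v ?N" "?M *\<^sub>v v = 0\<^sub>v ?N"
    using det_0_iff_vec_prod_zero[OF M] by blast
  have row: "(\<Sum>k<?N. merge i j (local_coord i j m (e k) (b t)) * v $ k) = 0" if t: "t < ?N" for t
  proof -
    have "(?M *\<^sub>v v) $ t = (\<Sum>k<?N. merge i j (local_coord i j m (e k) (b t)) * v $ k)"
      using t v(1) by (auto simp: coord_mat_def scalar_prod_def atLeast0LessThan intro!: sum.cong)
    then show ?thesis using v(3) t by simp
  qed
  define w where "w \<sigma> = v $ (inv_into {..<?N} e \<sigma>)" for \<sigma>
  have w: "w (e k) = v $ k" if "k < ?N" for k
    using that bij_betw_inv_into_left[OF e] by (simp add: w_def)
  have "w \<sigma> = 0" if \<sigma>: "\<sigma> \<in> perms n" for \<sigma>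
  proof (rule local_coord_independent[where v = w, OF n ij _ \<sigma>])
    fix P assume "P \<in> QI n m"
    then obtain c where c: "\<And>t. t < ?N \<Longrightarrow> c t \<in> sym_polys n" "P = (\<Sum>t<?N. c t * b t)"
      using b unfolding is_sym_basis_def by blast
    have bQI: "\<And>t. t < ?N \<Longrightarrow> b t \<in> QI n m" using b unfolding is_sym_basis_def by blast
    have "(\<Sum>\<sigma>\<in>perms n. w \<sigma> * merge i j (local_coord i j m \<sigma> P))
        = (\<Sum>k<?N. w (e k) * merge i j (local_coord i j m (e k) P))"
      by (rule sum.reindex_bij_betw[OF e, symmetric])
    also have "\<dots> = (\<Sum>k<?N. \<Sum>t<?N. merge i j (c t) *
        (merge i j (local_coord i j m (e k) (b t)) * v $ k))"
    proof (intro sum.cong refl)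
      fix k assume k: "k \<in> {..<?N}"
      have "local_coord i j m (e k) P = (\<Sum>t<?N. c t * local_coord i j m (e k) (b t))"
        unfolding c(2) using bij_betwE[OF e] k c(1) bQI by (intro local_coord_sum[OF n ij']) auto
      then show "w (e k) * merge i j (local_coord i j m (e k) P)
          = (\<Sum>t<?N. merge i j (c t) * (merge i j (local_coord i j m (e k) (b t)) * v $ k))"
        using k w by (simp add: perm_act.hom_sum perm_act.hom_mult sum_distrib_left mult_ac)
    qed
    also have "\<dots> = (\<Sum>t<?N. merge i j (c t) *
        (\<Sum>k<?N. merge i j (local_coord i j m (e k) (b t)) * v $ k))"
      unfolding sum_distrib_left by (rule sum.swap)
    also have "\<dots> = 0" using row by simp
    finally show "(\<Sum>\<sigma>\<in>perms n. w \<sigma> * merge i j (local_coord i j m \<sigma> P)) = 0" .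
  qed
  then have "v $ k = 0" if "k < ?N" for k
    using w[OF that] bij_betwE[OF e] that by force
  then have "v = 0\<^sub>v ?N" using v(1) by (intro eq_vecI) auto
  with v(2) show False by simp
qed

text \<open>Linearity turns B times the matrix of b into the level m coordinates of a. These are the
  level m + 1 coordinates with each descending column scaled by \<open>(X i - X j) ^ 2\<close>,
  which the diagonal matrix D records.\<close>

lemma det_base_change_coord_mat:
  assumes n: "n \<ge> 1" and ij: "(i, j) \<in> distinct_pairs n"
    and e: "bij_betw e {..<fact n} (perms n)"
    and B: "B \<in> carrier_mat (fact n) (fact n)"
      "\<And>s t. s < fact n \<Longrightarrow> t < fact n \<Longrightarrow> B $$ (s, t) \<in> sym_polys n"
    and ab: "\<And>s. s < fact n \<Longrightarrow> a s = (\<Sum>t<fact n. B $$ (s, t) * b t)"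
    and a: "\<And>s. s < fact n \<Longrightarrow> a s \<in> QI n (m + 1)"
    and b: "\<And>t. t < fact n \<Longrightarrow> b t \<in> QI n m"
  shows "det B * det (coord_mat n i j m e b) = (X i - X j) ^ fact n * det (coord_mat n i j (m + 1) e a)"
proof -
  let ?N = "fact n :: nat"
  define g where "g \<sigma> = (if ascending i j \<sigma> then 1 else (X i - X j) ^ 2)" for \<sigma>
  define D where "D = mat ?N ?N (\<lambda>(k, l). if k = l then g (e k) else 0)"
  have D: "D \<in> carrier_mat ?N ?N" by (simp add: D_def)
  have "B * coord_mat n i j m e b = coord_mat n i j (m + 1) e a * D"
  proof (rule eq_matI)
    fix s k assume "s < dim_row (coord_mat n i j (m + 1) e a * D)"
      "k < dim_col (coord_mat n i j (m + 1) e a * D)"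
    then have s: "s < ?N" and k: "k < ?N" by (auto simp: coord_mat_def D_def)
    have ek: "e k \<in> perms n" using bij_betwE[OF e] k by blast
    have "(B * coord_mat n i j m e b) $$ (s, k) = (\<Sum>t<?N. B $$ (s, t) * local_coord i j m (e k) (b t))"
      using s k B(1) by (auto simp: coord_mat_def scalar_prod_def atLeast0LessThan intro!: sum.cong)
    also have "\<dots> = local_coord i j m (e k) (a s)"
      unfolding ab[OF s] using s B(2) b by (intro local_coord_sum[OF n ij ek, symmetric]) auto
    also have "\<dots> = local_coord i j (m + 1) (e k) (a s) * g (e k)"
      using local_coord_Suc[OF n ij ek a[OF s]] by (simp add: g_def)
    also have "\<dots> = (\<Sum>l<?N. local_coord i j (m + 1) (e l) (a s) * (if l = k then g (e l) else 0))"
      using k by (simp add: if_distrib[of "(*) _"] sum.delta cong: if_cong)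
    also have "\<dots> = (coord_mat n i j (m + 1) e a * D) $$ (s, k)"
      using s k by (auto simp: coord_mat_def D_def scalar_prod_def atLeast0LessThan intro!: sum.cong)
    finally show "(B * coord_mat n i j m e b) $$ (s, k) = (coord_mat n i j (m + 1) e a * D) $$ (s, k)" .
  qed (use B(1) in \<open>auto simp: coord_mat_def D_def\<close>)
  then have "det B * det (coord_mat n i j m e b) = det (coord_mat n i j (m + 1) e a) * det D"
    using det_mult[OF B(1) coord_mat_carrier] det_mult[OF coord_mat_carrier D] by metis
  moreover have "det D = (X i - X j) ^ ?N"
  proof -
    have "det D = prod_list (diag_mat D)"
      by (rule det_upper_triangular[OF _ D]) (auto simp: D_def)
    also have "\<dots> = (\<Prod>k<?N. g (e k))"
      unfolding prod_list_diag_prod by (auto simp: D_def atLeast0LessThan intro!: prod.cong)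
    also have "\<dots> = (\<Prod>\<sigma>\<in>perms n. g \<sigma>)" by (rule prod.reindex_bij_betw[OF e])
    also have "\<dots> = (\<Prod>\<sigma>\<in>{\<sigma> \<in> perms n. \<not> ascending i j \<sigma>}. (X i - X j) ^ 2)"
      unfolding g_def by (intro prod.mono_neutral_cong_right) auto
    also have "\<dots> = (X i - X j) ^ ?N"
      unfolding card_descending[OF ij, symmetric] by (simp add: power_mult)
    finally show ?thesis .
  qed
  ultimately show ?thesis by (simp add: mult.commute)
qed

section \<open>Inverting the base change up to a scalar\<close>

lemma sym_polys_iff:
  "n \<ge> 1 \<Longrightarrow> P \<in> sym_polys n \<longleftrightarrow>
    perm_act (retract n) P = P \<and> (\<forall>\<pi>. \<pi> permutes {1..n} \<longrightarrow> perm_act \<pi> P = P)"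
  by (simp add: sym_polys_def poly_ring_iff)

lemma sym_polys_mult:
  "n \<ge> 1 \<Longrightarrow> P \<in> sym_polys n \<Longrightarrow> Q \<in> sym_polys n \<Longrightarrow> P * Q \<in> sym_polys n"
  by (simp add: sym_polys_iff perm_act.hom_mult)

lemma sym_polys_diff:
  "n \<ge> 1 \<Longrightarrow> P \<in> sym_polys n \<Longrightarrow> Q \<in> sym_polys n \<Longrightarrow> P - Q \<in> sym_polys n"
  by (simp add: sym_polys_iff perm_act.hom_minus)

lemma sym_polys_sum:
  assumes "n \<ge> 1" "\<And>x. x \<in> A \<Longrightarrow> f x \<in> sym_polys n"
  shows "sum f A \<in> sym_polys n"
  using assms by (simp add: sym_polys_iff perm_act.hom_sum)

text \<open>Expanding \<open>vandermonde n ^ 2 * b s\<close> in the basis a gives a matrix C. Since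
  coordinates with respect to b are unique, C times B is the scalar matrix of
  \<open>vandermonde n ^ 2\<close>; take determinants.\<close>

lemma det_base_change_dvd:
  assumes n: "n \<ge> 1"
    and a: "is_sym_basis n (QI n (m + 1)) N a"
    and b: "is_sym_basis n (QI n m) N b"
    and B: "B \<in> carrier_mat N N" "\<And>s t. s < N \<Longrightarrow> t < N \<Longrightarrow> B $$ (s, t) \<in> sym_polys n"
    and ab: "\<And>s. s < N \<Longrightarrow> a s = (\<Sum>t<N. B $$ (s, t) * b t)"
  shows "det B dvd (vandermonde n ^ 2) ^ N"
proof -
  let ?D = "vandermonde n ^ 2"
  have "\<exists>c. (\<forall>t<N. c t \<in> sym_polys n) \<and> ?D * b s = (\<Sum>t<N. c t * a t)" if "s < N" for s
    using that a b QI_vandermonde_square_mult[OF n, of "b s" m] unfolding is_sym_basis_def by blast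
  then obtain c where c: "\<And>s t. s < N \<Longrightarrow> t < N \<Longrightarrow> c s t \<in> sym_polys n"
    "\<And>s. s < N \<Longrightarrow> ?D * b s = (\<Sum>t<N. c s t * a t)"
    by metis
  define C where "C = mat N N (\<lambda>(s, t). c s t)"
  have C: "C \<in> carrier_mat N N" by (simp add: C_def)
  have "C * B = ?D \<cdot>\<^sub>m 1\<^sub>m N"
  proof (rule eq_matI)
    fix s u assume "s < dim_row (?D \<cdot>\<^sub>m 1\<^sub>m N)" "u < dim_col (?D \<cdot>\<^sub>m 1\<^sub>m N)"
    then have s: "s < N" and u: "u < N" by auto
    define g where "g u = (\<Sum>t<N. c s t * B $$ (t, u)) - (if u = s then ?D else 0)" for u
    have "0 \<in> sym_polys n" using sym_polys_sum[OF n, of "{}"] by simp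
    then have "g u \<in> sym_polys n" if "u < N" for u
      unfolding g_def using c(1)[OF s] B(2) that vandermonde_square_sym[OF n]
      by (intro sym_polys_diff[OF n] sym_polys_sum[OF n] sym_polys_mult[OF n]) auto
    moreover have "(\<Sum>u<N. g u * b u) = 0"
    proof -
      have "(\<Sum>u<N. \<Sum>t<N. c s t * B $$ (t, u) * b u) = (\<Sum>t<N. c s t * a t)"
        by (subst sum.swap) (simp add: ab sum_distrib_left mult.assoc)
      moreover have "(\<Sum>u<N. (if u = s then ?D else 0) * b u) = ?D * b s"
        using s by (simp add: if_distrib[of "\<lambda>x. x * _"] cong: if_cong)
      ultimately show ?thesis
        using c(2)[OF s] by (simp add: g_def left_diff_distrib sum_subtractf sum_distrib_right)
    qed
    ultimately have "g u = 0" using b u unfolding is_sym_basis_def by blast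
    moreover have "(C * B) $$ (s, u) = (\<Sum>t<N. c s t * B $$ (t, u))"
      using s u B(1) by (auto simp: C_def scalar_prod_def atLeast0LessThan intro!: sum.cong)
    ultimately show "(C * B) $$ (s, u) = (?D \<cdot>\<^sub>m 1\<^sub>m N) $$ (s, u)"
      using s u by (auto simp: g_def)
  qed (use B C in auto)
  then have "det C * det B = ?D ^ N" using det_mult[OF C B(1)] by simp
  then show ?thesis by (metis dvd_triv_right)
qed

lemma vandermonde_power_dvd:
  assumes "\<And>i j. (i, j) \<in> pairs n \<Longrightarrow> (X i - X j) ^ k dvd P"
  shows "vandermonde n ^ k dvd P"
  unfolding vandermonde_eq
proof (rule prod_prime_elem_power_dvd[OF finite_pairs(1)])
  show "prime_elem (diff p)" if "p \<in> pairs n" for p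
    using that by (auto simp: pairs_def intro: prime_elem_diff)
  show "diff p ^ k dvd P" if "p \<in> pairs n" for p
    using that assms by (cases p) auto
  show "\<not> diff p dvd diff q" if pq: "p \<in> pairs n" "q \<in> pairs n" "p \<noteq> q" for p q
  proof -
    obtain i j k l where "p = (i, j)" "q = (k, l)" by (cases p, cases q)
    then show ?thesis
      using pq diff_dvd_diff_iff[of i j k l] by (auto simp: pairs_def doubleton_eq_iff)
  qed
qed

theorem theorem8p1:
  fixes n m :: nat
    and a b :: "nat \<Rightarrow> rpoly"
    and B :: "rpoly mat"
  assumes "n \<ge> 1"
    and "is_sym_basis n (QI n (m + 1)) (fact n) a"
    and "is_sym_basis n (QI n m) (fact n) b"
    and "B \<in> carrier_mat (fact n) (fact n)"
    and "\<And>s t. s < fact n \<Longrightarrow> t < fact n \<Longrightarrow> B $$ (s, t) \<in> sym_polys n"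
    and "\<And>s. s < fact n \<Longrightarrow> a s = (\<Sum>t<fact n. B $$ (s, t) * b t)"
  shows "\<exists>c :: rat. det B = const c * vandermonde n ^ fact n"
proof -
  let ?N = "fact n :: nat"
  have "\<exists>e. bij_betw e {..<?N} (perms n)"
    using ex_bij_betw_nat_finite[OF finite_perms, of n] by (simp add: card_perms atLeast0LessThan)
  then obtain e where e: "bij_betw e {..<?N} (perms n)" by blast
  have local_det: "det B * det (coord_mat n i j m e b)
      = (X i - X j) ^ ?N * det (coord_mat n i j (m + 1) e a)" if "(i, j) \<in> pairs n" for i j
    using assms unfolding is_sym_basis_def
    by (intro det_base_change_coord_mat[OF assms(1) subsetD[OF pairs_subset that] e]) auto
  have prime: "prime_elem (X i - X j)" if "(i, j) \<in> pairs n" for i j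
    using that by (auto simp: pairs_def intro: prime_elem_diff)
  have "vandermonde n ^ ?N dvd det B"
  proof (rule vandermonde_power_dvd)
    fix i j assume ij: "(i, j) \<in> pairs n"
    have "(X i - X j) ^ ?N dvd det B * det (coord_mat n i j m e b)"
      unfolding local_det[OF ij] by (rule dvd_triv_left)
    then show "(X i - X j) ^ ?N dvd det B"
      by (rule prime_elem_power_dvd_cancel[OF prime[OF ij] _ det_coord_mat[OF assms(1) ij e assms(3)]])
  qed
  then obtain P where P: "det B = vandermonde n ^ ?N * P" by (rule dvdE)
  \<comment> \<open>A further factor \<open>X i - X j\<close> in P would divide the coordinate
    determinant of a at level m + 1.\<close>
  have P_coprime: "\<not> X i - X j dvd P" if ij: "(i, j) \<in> pairs n" for i j
  proof
    assume "X i - X j dvd P"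
    obtain Y where Y: "vandermonde n = (X i - X j) * Y"
      by (rule vandermonde_cofactor[OF ij])
    have "(X i - X j) ^ ?N * (P * (Y ^ ?N * det (coord_mat n i j m e b)))
        = (X i - X j) ^ ?N * det (coord_mat n i j (m + 1) e a)"
      using local_det[OF ij] by (simp add: P Y power_mult_distrib mult_ac)
    moreover have "(X i - X j) ^ ?N \<noteq> 0" using ij by (auto simp: pairs_def)
    ultimately have "P * (Y ^ ?N * det (coord_mat n i j m e b)) = det (coord_mat n i j (m + 1) e a)"
      using mult_left_cancel by blast
    then have "X i - X j dvd det (coord_mat n i j (m + 1) e a)"
      using \<open>X i - X j dvd P\<close> by (metis dvd_mult2)
    then show False using det_coord_mat[OF assms(1) ij e assms(2)] by blast
  qed
  obtain Q where "(vandermonde n ^ 2) ^ ?N = det B * Q"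
    using det_base_change_dvd[OF assms] by (rule dvdE)
  then have "vandermonde n ^ ?N * vandermonde n ^ ?N = vandermonde n ^ ?N * (P * Q)"
    by (simp add: P power2_eq_square power_mult_distrib mult.assoc)
  then have PQ: "Q * P = vandermonde n ^ ?N"
    using vandermonde_neq_0[of n] by (simp add: mult.commute)
  \<comment> \<open>P has no factor in common with the right-hand side of \<open>PQ\<close>, so the
    whole power lies in Q, and cancelling it leaves P a unit.\<close>
  have "vandermonde n ^ ?N dvd Q"
  proof (rule vandermonde_power_dvd)
    fix i j assume ij: "(i, j) \<in> pairs n"
    then have "(X i - X j) ^ ?N dvd Q * P"
      unfolding PQ using diff_dvd_vandermonde pairs_subset by (intro dvd_power_same) blast
    then show "(X i - X j) ^ ?N dvd Q"
      by (rule prime_elem_power_dvd_cancel[OF prime[OF ij] _ P_coprime[OF ij]])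
  qed
  then obtain R where "Q = vandermonde n ^ ?N * R" by (rule dvdE)
  then have "P * R = 1"
    using PQ vandermonde_neq_0[of n] by (simp add: mult_ac)
  then obtain c where "P = const c" using rpoly_unit_const by blast
  then show ?thesis using P by (auto simp: mult.commute)
qed

end
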